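(* Let $J\subset P$ be an invariant mapping cone and let $\phi\in P$. Then the following conditions are equivalent: (i) $\phi\in J^o$. (ii) $\phi\circ\alpha\in CP$ for all $\alpha\in J$. (iii) $\alpha\circ\phi\in CP$ for all $\alpha\in J$. (iv) $\widetilde\phi\circ(\iota\otimes\alpha)\ge 0$ for all $\alpha\in J$. (v) $(\iota\otimes\alpha)(C_\phi)\ge 0$ for all $\alpha\in J$. (vi) $\phi\circ\alpha\in SP$ for all $\alpha\in J$. (vii) $\alpha\circ\phi\in SP$ for all $\alpha\in J$.
   Context: Let $M_n$ be the algebra of complex $n\times n$ matrices, $M_n^+$ its positive semidefinite matrices, $Tr$ the usual trace (on $M_n$ or on $M_n\otimes M_n$), $t$ the transpose on $M_n$, $\iota$ the identity map on $M_n$, and $(e_{ij})$ the standard matrix units of $M_n$. $P$ is the cone of all positive linear maps $\phi:M_n\to M_n$, i.e. $\phi(M_n^+)\subset M_n^+$. $CP$ is the cone of completely positive maps $M_n\to M_n$, equivalently maps of the form $a\mapsto\sum_i V_i^*aV_i$ (finite sum, $V_i\in M_n$). $SP$ is the cone of super-positive (entanglement breaking) maps, i.e. maps of the form $a\mapsto\sum_i\omega_i(a)a_i$ (finite sum) with $a_i\in M_n^+$ and $\omega_i$ states on $M_n$. The Choi matrix of a linear map $\phi:M_n\to M_n$ is $C_\phi=\sum_{i,j}e_{ij}\otimes\phi(e_{ij})\in M_n\otimes M_n$. For $\phi\in P$, $\widetilde\phi$ is the linear functional on $M_n\otimes M_n$ determined by $\widetilde\phi(a\otimes b)=Tr(\phi(a)b^t)$;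 for a linear functional, $\ge 0$ means that it is a positive functional. A mapping cone is a closed convex cone $J\subset P$ such that $\phi\in J$ implies $\alpha\circ\phi\circ\beta\in J$ for all $\alpha,\beta\in CP$. All mapping cones are assumed symmetric: $\phi\in J$ implies $\phi^*\in J$ and $\phi^t\in J$, where $Tr(\phi(a)b)=Tr(a\phi^*(b))$ and $\phi^t(a)=\phi(a^t)^t$ for all $a,b\in M_n$. A mapping cone $J$ is invariant if $\phi\in J$ implies $\alpha\circ\phi\circ\beta\in J$ for all $\alpha,\beta\in P$. The dual cone of $J$ is $J^o=\{\phi\in P: Tr(C_\phi C_\psi)\ge 0\ \text{for all}\ \psi\in J\}$. *)

theory Defs
  imports "HOL-Analysis.Analysis" "HOL-Library.Complex_Order"
begin

text \<open>
  \<open>M\<^sub>n\<close> is \<^typ>\<open>complex^'n^'n\<close> with \<open>n = CARD('n)\<close>, and \<open>M\<^sub>n \<otimes> M\<^sub>n\<close> is identified with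
  \<^typ>\<open>complex^('n \<times> 'n)^('n \<times> 'n)\<close> through the Kronecker product \<open>kron\<close> below.  The order on
  \<^typ>\<open>complex\<close> is that of \<open>Complex_Order\<close>: \<open>0 \<le> z\<close> means that \<open>z\<close> is real and nonnegative.
\<close>

definition cscale :: "complex \<Rightarrow> complex^'m^'n \<Rightarrow> complex^'m^'n" where
  "cscale c A = (\<chi> i j. c * A $ i $ j)"

abbreviation linear_map :: "(complex^'m^'m \<Rightarrow> complex^'n^'n) \<Rightarrow> bool" where
  "linear_map \<equiv> Vector_Spaces.linear cscale cscale"

abbreviation linear_functional :: "(complex^'m^'m \<Rightarrow> complex) \<Rightarrow> bool" where
  "linear_functional \<equiv> Vector_Spaces.linear cscale (*)"

definition munit :: "'n::finite \<Rightarrow> 'n \<Rightarrow> complex^'n^'n" where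
  "munit i j = (\<chi> k l. if k = i \<and> l = j then 1 else 0)"

definition kron :: "complex^'m^'m \<Rightarrow> complex^'n^'n \<Rightarrow> complex^('m \<times> 'n)^('m \<times> 'n)" where
  "kron a b = (\<chi> p q. a $ fst p $ fst q * b $ snd p $ snd q)"

text \<open>Over \<open>\<complex>\<close>, nonnegativity of the quadratic form already forces the matrix to be Hermitian.\<close>

definition psd :: "complex^'n^'n \<Rightarrow> bool" where
  "psd A \<longleftrightarrow> (\<forall>v::complex^'n. 0 \<le> (\<Sum>i\<in>UNIV. \<Sum>j\<in>UNIV. cnj (v $ i) * A $ i $ j * v $ j))"

definition positive_functional :: "(complex^'m^'m \<Rightarrow> complex) \<Rightarrow> bool" where
  "positive_functional f \<longleftrightarrow> linear_functional f \<and> (\<forall>x. psd x \<longrightarrow> 0 \<le> f x)"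

definition state :: "(complex^'n^'n \<Rightarrow> complex) \<Rightarrow> bool" where
  "state \<omega> \<longleftrightarrow> positive_functional \<omega> \<and> \<omega> (mat 1) = 1"

definition positive_maps :: "(complex^'n^'n \<Rightarrow> complex^'n^'n) set" where
  "positive_maps = {\<phi>. linear_map \<phi> \<and> (\<forall>a. psd a \<longrightarrow> psd (\<phi> a))}"

text \<open>
  A \<open>k \<times> k\<close> block matrix with blocks in \<open>M\<^sub>n\<close> (an element of \<open>M\<^sub>k \<otimes> M\<^sub>n\<close>) is given as a function
  \<^typ>\<open>nat \<Rightarrow> nat \<Rightarrow> complex^'n^'n\<close>, of which only the values at \<open>p, q < k\<close> matter; thus \<open>k\<close> can be
  quantified inside the definition of complete positivity.
\<close>

definition block_psd :: "nat \<Rightarrow> (nat \<Rightarrow> nat \<Rightarrow> complex^'n^'n) \<Rightarrow> bool" where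
  "block_psd k A \<longleftrightarrow>
    (\<forall>v::nat \<Rightarrow> complex^'n.
      0 \<le> (\<Sum>p<k. \<Sum>q<k. \<Sum>i\<in>UNIV. \<Sum>j\<in>UNIV. cnj (v p $ i) * A p q $ i $ j * v q $ j))"

definition completely_positive_maps :: "(complex^'n^'n \<Rightarrow> complex^'n^'n) set" where
  "completely_positive_maps =
    {\<phi>. linear_map \<phi> \<and> (\<forall>k A. block_psd k A \<longrightarrow> block_psd k (\<lambda>p q. \<phi> (A p q)))}"

definition super_positive_maps :: "(complex^'n^'n \<Rightarrow> complex^'n^'n) set" where
  "super_positive_maps =
    {\<phi>. \<exists>(m::nat) \<omega> a. (\<forall>i<m. state (\<omega> i) \<and> psd (a i)) \<and>
         \<phi> = (\<lambda>x. \<Sum>i<m. cscale (\<omega> i x) (a i))}"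

definition choi :: "(complex^'n^'n \<Rightarrow> complex^'n^'n) \<Rightarrow> complex^('n \<times> 'n)^('n \<times> 'n)" where
  "choi \<phi> = (\<Sum>i\<in>UNIV. \<Sum>j\<in>UNIV. kron (munit i j) (\<phi> (munit i j)))"

text \<open>
  The following two definite descriptions are well defined for linear \<open>\<phi>\<close>; see
  \<open>ex1_trace_adjoint\<close> and \<open>ex1_dual_functional\<close> below.
\<close>

definition trace_adjoint :: "(complex^'n^'n \<Rightarrow> complex^'n^'n) \<Rightarrow> complex^'n^'n \<Rightarrow> complex^'n^'n" where
  "trace_adjoint \<phi> = (THE \<psi>. \<forall>a b. trace (\<phi> a ** b) = trace (a ** \<psi> b))"

definition dual_functional ::
    "(complex^'n^'n \<Rightarrow> complex^'n^'n) \<Rightarrow> complex^('n \<times> 'n)^('n \<times> 'n) \<Rightarrow> complex" where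
  "dual_functional \<phi> =
    (THE f. linear_functional f \<and> (\<forall>a b. f (kron a b) = trace (\<phi> a ** transpose b)))"

definition transpose_map :: "(complex^'n^'n \<Rightarrow> complex^'n^'n) \<Rightarrow> complex^'n^'n \<Rightarrow> complex^'n^'n" where
  "transpose_map \<phi> = (\<lambda>a. transpose (\<phi> (transpose a)))"

text \<open>
  \<open>\<phi> \<otimes> \<psi>\<close>, by linear extension from the basis \<open>e\<^sub>i\<^sub>j \<otimes> e\<^sub>k\<^sub>l\<close>; the lemmas \<open>linear_tensor_map\<close>,
  \<open>tensor_map_kron\<close> and \<open>tensor_map_unique\<close> below characterise it on simple tensors.
\<close>

definition tensor_map ::
    "(complex^'n^'n \<Rightarrow> complex^'n^'n) \<Rightarrow> (complex^'n^'n \<Rightarrow> complex^'n^'n) \<Rightarrow>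
     complex^('n \<times> 'n)^('n \<times> 'n) \<Rightarrow> complex^('n \<times> 'n)^('n \<times> 'n)" where
  "tensor_map \<phi> \<psi> x =
    (\<Sum>p\<in>UNIV. \<Sum>q\<in>UNIV. cscale (x $ p $ q)
       (kron (\<phi> (munit (fst p) (fst q))) (\<psi> (munit (snd p) (snd q)))))"

text \<open>
  \<open>closed\<close> refers to the topology of pointwise convergence on functions, which on the
  finite-dimensional space of linear maps is the norm topology; the linear maps form a closed
  subset.
\<close>

definition mapping_cone :: "(complex^'n^'n \<Rightarrow> complex^'n^'n) set \<Rightarrow> bool" where
  "mapping_cone J \<longleftrightarrow>
     J \<subseteq> positive_maps \<and> closed J \<and> J \<noteq> {} \<and>
     (\<forall>\<phi>\<in>J. \<forall>\<psi>\<in>J. (\<lambda>a. \<phi> a + \<psi> a) \<in> J) \<and>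
     (\<forall>\<phi>\<in>J. \<forall>c::real. 0 \<le> c \<longrightarrow> (\<lambda>a. c *\<^sub>R \<phi> a) \<in> J) \<and>
     (\<forall>\<phi>\<in>J. \<forall>\<alpha>\<in>completely_positive_maps. \<forall>\<beta>\<in>completely_positive_maps. \<alpha> \<circ> \<phi> \<circ> \<beta> \<in> J)"

definition symmetric_cone :: "(complex^'n^'n \<Rightarrow> complex^'n^'n) set \<Rightarrow> bool" where
  "symmetric_cone J \<longleftrightarrow> (\<forall>\<phi>\<in>J. trace_adjoint \<phi> \<in> J \<and> transpose_map \<phi> \<in> J)"

definition invariant_mapping_cone :: "(complex^'n^'n \<Rightarrow> complex^'n^'n) set \<Rightarrow> bool" where
  "invariant_mapping_cone J \<longleftrightarrow>
     mapping_cone J \<and> symmetric_cone J \<and>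
     (\<forall>\<phi>\<in>J. \<forall>\<alpha>\<in>positive_maps. \<forall>\<beta>\<in>positive_maps. \<alpha> \<circ> \<phi> \<circ> \<beta> \<in> J)"

definition dual_cone ::
    "(complex^'n^'n \<Rightarrow> complex^'n^'n) set \<Rightarrow> (complex^'n^'n \<Rightarrow> complex^'n^'n) set" where
  "dual_cone J = {\<phi> \<in> positive_maps. \<forall>\<psi>\<in>J. 0 \<le> trace (choi \<phi> ** choi \<psi>)}"


lemma vector_space_cscale: "vector_space (cscale :: complex \<Rightarrow> complex^'m^'n \<Rightarrow> _)"
  by unfold_locales (simp_all add: cscale_def vec_eq_iff algebra_simps)

lemma vector_space_mult: "vector_space ((*) :: complex \<Rightarrow> complex \<Rightarrow> complex)"
  by unfold_locales (simp_all add: algebra_simps)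

lemma linear_map_iff:
  "linear_map f \<longleftrightarrow> (\<forall>x y. f (x + y) = f x + f y) \<and> (\<forall>c x. f (cscale c x) = cscale c (f x))"
  by (simp add: Vector_Spaces.linear_def module_hom_def module_hom_axioms_def
      module_iff_vector_space vector_space_cscale)

lemma linear_functional_iff:
  "linear_functional f \<longleftrightarrow> (\<forall>x y. f (x + y) = f x + f y) \<and> (\<forall>c x. f (cscale c x) = c * f x)"
  by (simp add: Vector_Spaces.linear_def module_hom_def module_hom_axioms_def
      module_iff_vector_space vector_space_cscale vector_space_mult)

lemma munit_expand: "A = (\<Sum>i\<in>UNIV. \<Sum>j\<in>UNIV. cscale (A $ i $ j) (munit i j))"
proof -
  have "(\<Sum>i\<in>UNIV. \<Sum>j\<in>UNIV. A $ i $ j * (if k = i \<and> l = j then 1 else 0)) = A $ k $ l" for k l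
  proof -
    have "(\<Sum>i\<in>UNIV. \<Sum>j\<in>UNIV. A $ i $ j * (if k = i \<and> l = j then 1 else 0)) =
        (\<Sum>i\<in>UNIV. if k = i then (\<Sum>j\<in>UNIV. if l = j then A $ i $ j else 0) else 0)"
      by (intro sum.cong refl) (auto simp: mult_delta_right)
    then show ?thesis by simp
  qed
  then show ?thesis
    by (simp add: vec_eq_iff cscale_def munit_def)
qed

lemma linear_expand:
  assumes "Vector_Spaces.linear cscale s f"
  shows "f A = (\<Sum>i\<in>UNIV. \<Sum>j\<in>UNIV. s (A $ i $ j) (f (munit i j)))"
proof -
  interpret l: Vector_Spaces.linear cscale s f by fact
  have "f A = f (\<Sum>i\<in>UNIV. \<Sum>j\<in>UNIV. cscale (A $ i $ j) (munit i j))"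
    using munit_expand[of A] by simp
  then show ?thesis by (simp add: l.sum l.scale)
qed

lemma munit_kron: "munit p q = kron (munit (fst p) (fst q)) (munit (snd p) (snd q))"
  by (auto simp: vec_eq_iff munit_def kron_def prod_eq_iff)

lemma linear_eq_on_kron:
  fixes f g :: "complex^('m::finite \<times> 'n::finite)^('m \<times> 'n) \<Rightarrow> 'b::ab_group_add"
  assumes "Vector_Spaces.linear cscale s f" "Vector_Spaces.linear cscale s g"
    and "\<And>a b. f (kron a b) = g (kron a b)"
  shows "f = g"
proof
  fix x
  have "f (munit p q) = g (munit p q)" for p q
    unfolding munit_kron by (rule assms(3))
  then show "f x = g x"
    by (subst linear_expand[OF assms(1)], subst linear_expand[OF assms(2)]) simp
qed

lemma trace_mult_munit: "trace (A ** munit i j) = A $ j $ i"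
proof -
  have "trace (A ** munit i j) = (\<Sum>k\<in>UNIV. \<Sum>m\<in>UNIV. A $ k $ m * (if m = i \<and> k = j then 1 else 0))"
    by (simp add: trace_def matrix_matrix_mult_def munit_def)
  also have "\<dots> = (\<Sum>k\<in>UNIV. if k = j then (\<Sum>m\<in>UNIV. if m = i then A $ k $ m else 0) else 0)"
    by (intro sum.cong refl) (auto simp: mult_delta_right)
  finally show ?thesis by simp
qed

lemma trace_munit_mult: "trace (munit i j ** A) = A $ j $ i"
  by (metis trace_mul_sym trace_mult_munit)

lemma matrix_mult_add_left: "(A + B) ** C = A ** C + (B::complex^'m^'n) ** C"
  by (simp add: vec_eq_iff matrix_matrix_mult_def distrib_right sum.distrib)

lemma cscale_mult_left: "cscale c A ** B = cscale c (A ** B)"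
  by (simp add: vec_eq_iff cscale_def matrix_matrix_mult_def sum_distrib_left mult.assoc)

lemma trace_cscale: "trace (cscale c A) = c * trace A"
  by (simp add: trace_def cscale_def sum_distrib_left)

lemma linear_trace_mult: "linear_map \<phi> \<Longrightarrow> linear_functional (\<lambda>a. trace (\<phi> a ** b))"
  by (simp add: linear_map_iff linear_functional_iff matrix_mult_add_left trace_add
      cscale_mult_left trace_cscale)

lemma ex1_trace_adjoint:
  assumes "linear_map \<phi>"
  shows "\<exists>!\<psi>. \<forall>a b. trace (\<phi> a ** b) = trace (a ** \<psi> b)"
proof (rule ex1I)
  let ?\<psi> = "\<lambda>b. \<chi> j i. trace (\<phi> (munit i j) ** b)"
  have id: "linear_map (\<lambda>a::complex^'n^'n. a)"
    by (simp add: linear_map_iff)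
  show "\<forall>a b. trace (\<phi> a ** b) = trace (a ** ?\<psi> b)"
  proof (intro allI)
    fix a b
    have "trace (\<phi> a ** b) = (\<Sum>i\<in>UNIV. \<Sum>j\<in>UNIV. a $ i $ j * trace (\<phi> (munit i j) ** b))"
      by (rule linear_expand[OF linear_trace_mult[OF assms]])
    also have "\<dots> = (\<Sum>i\<in>UNIV. \<Sum>j\<in>UNIV. a $ i $ j * trace (munit i j ** ?\<psi> b))"
      by (simp add: trace_munit_mult)
    also have "\<dots> = trace (a ** ?\<psi> b)"
      by (rule linear_expand[OF linear_trace_mult[OF id], symmetric])
    finally show "trace (\<phi> a ** b) = trace (a ** ?\<psi> b)" .
  qed
  fix \<psi> assume "\<forall>a b. trace (\<phi> a ** b) = trace (a ** \<psi> b)"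
  then show "\<psi> = ?\<psi>"
    by (auto simp: fun_eq_iff vec_eq_iff trace_munit_mult)
qed

lemma linear_sum_coeff:
  "linear_functional (\<lambda>x. \<Sum>p\<in>UNIV. \<Sum>q\<in>UNIV. x $ p $ q * c p q)"
  by (simp add: linear_functional_iff cscale_def algebra_simps sum.distrib sum_distrib_left)

lemma sum_UNIV_pairs:
  "(\<Sum>p\<in>(UNIV::('m::finite \<times> 'n::finite) set). f (fst p) (snd p)) = (\<Sum>i\<in>UNIV. \<Sum>k\<in>UNIV. f i k)"
  by (simp add: UNIV_Times_UNIV[symmetric] sum.cartesian_product case_prod_beta
      del: UNIV_Times_UNIV)

lemma sum_kron:
  fixes f :: "'a::finite \<Rightarrow> 'b::finite \<Rightarrow> 'c::finite \<Rightarrow> 'd::finite \<Rightarrow> 'e::comm_monoid_add"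
  shows "(\<Sum>p\<in>UNIV. \<Sum>q\<in>UNIV. f (fst p) (snd p) (fst q) (snd q)) =
   (\<Sum>i\<in>UNIV. \<Sum>j\<in>UNIV. \<Sum>k\<in>UNIV. \<Sum>l\<in>UNIV. f i k j l)"
proof -
  have "(\<Sum>p\<in>UNIV. \<Sum>q\<in>UNIV. f (fst p) (snd p) (fst q) (snd q)) =
      (\<Sum>p\<in>UNIV. \<Sum>j\<in>UNIV. \<Sum>l\<in>UNIV. f (fst p) (snd p) j l)"
    by (simp add: sum_UNIV_pairs)
  also have "\<dots> = (\<Sum>i\<in>UNIV. \<Sum>k\<in>UNIV. \<Sum>j\<in>UNIV. \<Sum>l\<in>UNIV. f i k j l)"
    by (rule sum_UNIV_pairs[where f = "\<lambda>i k. \<Sum>j\<in>UNIV. \<Sum>l\<in>UNIV. f i k j l"])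
  also have "\<dots> = (\<Sum>i\<in>UNIV. \<Sum>j\<in>UNIV. \<Sum>k\<in>UNIV. \<Sum>l\<in>UNIV. f i k j l)"
    by (intro sum.cong refl) (rule sum.swap)
  finally show ?thesis .
qed

lemma ex1_dual_functional:
  assumes "linear_map \<phi>"
  shows "\<exists>!f. linear_functional f \<and> (\<forall>a b. f (kron a b) = trace (\<phi> a ** transpose b))"
proof (rule ex_ex1I)
  let ?f = "\<lambda>x. \<Sum>p\<in>UNIV. \<Sum>q\<in>UNIV. x $ p $ q * \<phi> (munit (fst p) (fst q)) $ snd p $ snd q"
  have "?f (kron a b) = trace (\<phi> a ** transpose b)" for a b
  proof -
    have "?f (kron a b) =
        (\<Sum>i\<in>UNIV. \<Sum>j\<in>UNIV. \<Sum>k\<in>UNIV. \<Sum>l\<in>UNIV. a $ i $ j * b $ k $ l * \<phi> (munit i j) $ k $ l)"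
      using sum_kron[of "\<lambda>i k j l. a $ i $ j * b $ k $ l * \<phi> (munit i j) $ k $ l"]
      by (simp add: kron_def)
    also have "\<dots> = (\<Sum>i\<in>UNIV. \<Sum>j\<in>UNIV. a $ i $ j * trace (\<phi> (munit i j) ** transpose b))"
      by (simp add: trace_def matrix_matrix_mult_def transpose_def sum_distrib_left mult_ac)
    also have "\<dots> = trace (\<phi> a ** transpose b)"
      by (rule linear_expand[OF linear_trace_mult[OF assms], symmetric])
    finally show ?thesis .
  qed
  then show "\<exists>f. linear_functional f \<and> (\<forall>a b. f (kron a b) = trace (\<phi> a ** transpose b))"
    using linear_sum_coeff[of "\<lambda>p q. \<phi> (munit (fst p) (fst q)) $ snd p $ snd q"]
    by (intro exI[of _ ?f]) blast
next
  fix f g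
  assume "linear_functional f \<and> (\<forall>a b. f (kron a b) = trace (\<phi> a ** transpose b))"
    and "linear_functional g \<and> (\<forall>a b. g (kron a b) = trace (\<phi> a ** transpose b))"
  then show "f = g" by (intro linear_eq_on_kron) auto
qed

lemma linear_tensor_map: "linear_map (tensor_map \<phi> \<psi>)"
  by (simp add: linear_map_iff tensor_map_def cscale_def vec_eq_iff algebra_simps sum.distrib
      sum_distrib_left)

lemma tensor_map_kron:
  assumes "linear_map \<phi>" "linear_map \<psi>"
  shows "tensor_map \<phi> \<psi> (kron a b) = kron (\<phi> a) (\<psi> b)"
proof -
  have "tensor_map \<phi> \<psi> (kron a b) $ p $ q = kron (\<phi> a) (\<psi> b) $ p $ q" for p q
  proof -
    have "tensor_map \<phi> \<psi> (kron a b) $ p $ q =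
        (\<Sum>i\<in>UNIV. \<Sum>j\<in>UNIV. \<Sum>k\<in>UNIV. \<Sum>l\<in>UNIV. a $ i $ j * b $ k $ l *
          (\<phi> (munit i j) $ fst p $ fst q * \<psi> (munit k l) $ snd p $ snd q))"
      using sum_kron[of "\<lambda>i k j l. a $ i $ j * b $ k $ l *
          (\<phi> (munit i j) $ fst p $ fst q * \<psi> (munit k l) $ snd p $ snd q)"]
      by (simp add: tensor_map_def kron_def cscale_def)
    also have "\<dots> = (\<Sum>i\<in>UNIV. \<Sum>j\<in>UNIV. a $ i $ j * \<phi> (munit i j) $ fst p $ fst q) *
        (\<Sum>k\<in>UNIV. \<Sum>l\<in>UNIV. b $ k $ l * \<psi> (munit k l) $ snd p $ snd q)"
      by (simp only: sum_distrib_right, simp only: sum_distrib_left, simp only: mult_ac)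
    also have "\<dots> = \<phi> a $ fst p $ fst q * \<psi> b $ snd p $ snd q"
      by (simp add: linear_expand[OF assms(1), of a] linear_expand[OF assms(2), of b] cscale_def)
    finally show ?thesis by (simp add: kron_def)
  qed
  then show ?thesis by (simp add: vec_eq_iff)
qed

lemma tensor_map_unique:
  assumes "linear_map \<phi>" "linear_map \<psi>" "linear_map f"
    and "\<And>a b. f (kron a b) = kron (\<phi> a) (\<psi> b)"
  shows "f = tensor_map \<phi> \<psi>"
  by (rule linear_eq_on_kron[OF assms(3) linear_tensor_map])
     (simp add: assms(4) tensor_map_kron[OF assms(1,2)])

end

theory Submission
  imports Defs
begin

text \<open>
  On the \<open>n\<^sup>2\<close>-dimensional space \<open>M\<^sub>n\<close> the pairing \<open>Tr(C\<^sub>\<phi> C\<^sub>\<psi>)\<close> is the trace of the operator \<open>\<psi>\<^sup>* \<circ> \<phi>\<close>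
  (\<open>trace_choi_mult\<close>).  As \<open>J\<close> is closed under adjoints, \<open>\<phi> \<in> J\<^sup>o\<close> says that the operator trace of
  \<open>\<gamma> \<circ> \<phi>\<close> is nonnegative for every \<open>\<gamma> \<in> J\<close>.  The operator trace is cyclic and \<open>J\<close> absorbs positive
  maps on either side.  So for \<open>\<phi> \<in> J\<^sup>o\<close>, \<open>\<alpha> \<in> J\<close> and any positive \<open>\<beta>\<close>, both
  \<open>tr(\<beta>\<phi>\<alpha>) = tr((\<alpha>\<beta>)\<phi>)\<close> and \<open>tr((\<beta>\<alpha>)\<phi>)\<close> are nonnegative: \<open>\<phi>\<alpha>\<close> and \<open>\<alpha>\<phi>\<close> lie in the dual of the cone of
  positive maps.  That dual is the cone of super-positive maps (\<open>super_positiveI\<close>), and super-positive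
  maps are completely positive.  The circle closes because a completely positive map has
  nonnegative operator trace (\<open>map_trace_nonneg\<close>): this trace is the quadratic form of the Choi matrix
  at the vector \<open>\<Sum>\<^sub>i e\<^sub>i \<otimes> e\<^sub>i\<close>.

  Conditions (iv) and (v) restate (iii) by Choi's theorem (\<open>completely_positive_iff_psd_choi\<close>):
  \<open>(\<iota> \<otimes> \<alpha>)(C\<^sub>\<phi>)\<close> is the Choi matrix of \<open>\<alpha> \<circ> \<phi>\<close>, and \<open>\<phi>\<close>'s dual functional composed with
  \<open>\<iota> \<otimes> \<alpha>\<close> has as its coefficients the entries of the Choi matrix of \<open>\<gamma> \<circ> \<phi>\<close>, where \<open>\<gamma>\<close> is the
  adjoint of \<open>\<alpha>\<^sup>t\<close> and runs through \<open>J\<close> together with \<open>\<alpha>\<close>.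

  The duality between positive and super-positive maps is a separation argument.  Choi matrices of
  super-positive maps contain the cone generated by the pure product states; this cone is closed, since the
  generators form a compact set on which the trace is \<open>1\<close>.  Were the Choi matrix of a map in the
  dual outside the cone, a Hermitian matrix would separate them, and this matrix is the Choi matrix
  of a positive map with which the given map pairs negatively.  Throughout,
  positive semidefinite matrices enter as sums of rank-one matrices (\<open>psd_sum_rank_one\<close>).
\<close>

section \<open>Positive semidefinite matrices as sums of rank-one matrices\<close>

definition sesq :: "complex^'n^'n \<Rightarrow> complex^'n \<Rightarrow> complex^'n \<Rightarrow> complex" where
  "sesq A u v = (\<Sum>i\<in>UNIV. \<Sum>j\<in>UNIV. cnj (u $ i) * A $ i $ j * v $ j)"

definition rank_one :: "complex^'n \<Rightarrow> complex^'n^'n" where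
  "rank_one v = (\<chi> i j. v $ i * cnj (v $ j))"

lemma psd_iff_sesq: "psd A \<longleftrightarrow> (\<forall>v. 0 \<le> sesq A v v)"
  by (simp add: psd_def sesq_def)

lemma sesq_add_left: "sesq A (u + v) w = sesq A u w + sesq A v w"
  by (simp add: sesq_def algebra_simps sum.distrib)

lemma sesq_add_right: "sesq A u (v + w) = sesq A u v + sesq A u w"
  by (simp add: sesq_def algebra_simps sum.distrib)

lemma sesq_scale_left: "sesq A (c *s u) v = cnj c * sesq A u v"
  by (simp add: sesq_def sum_distrib_left mult_ac)

lemma sesq_scale_right: "sesq A u (c *s v) = c * sesq A u v"
  by (simp add: sesq_def sum_distrib_left mult_ac)

lemma sesq_axis_left: "sesq A (axis k 1) v = (\<Sum>j\<in>UNIV. A $ k $ j * v $ j)"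
proof -
  have "sesq A (axis k 1) v =
      (\<Sum>i\<in>UNIV. if i = k then (\<Sum>j\<in>UNIV. A $ k $ j * v $ j) else 0)"
    unfolding sesq_def by (intro sum.cong refl) (simp add: axis_def)
  then show ?thesis by simp
qed

lemma sesq_axis_right: "sesq A v (axis k 1) = (\<Sum>i\<in>UNIV. cnj (v $ i) * A $ i $ k)"
proof -
  have "(\<Sum>j\<in>UNIV. cnj (v $ i) * A $ i $ j * axis k 1 $ j) = cnj (v $ i) * A $ i $ k" for i
    by (simp add: axis_def if_distrib[of "(*) _"] cong: if_cong)
  then show ?thesis by (simp add: sesq_def)
qed

lemma sesq_axis_axis: "sesq A (axis k 1) (axis l 1) = A $ k $ l"
  unfolding sesq_axis_left by (simp add: axis_def if_distrib[of "(*) _"] cong: if_cong)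

lemma sesq_perturb_axis:
  "sesq A (u + c *s axis k 1) (u + c *s axis k 1) =
    sesq A u u + c * sesq A u (axis k 1) + cnj c * sesq A (axis k 1) u + c * cnj c * A $ k $ k"
  by (simp add: sesq_add_left sesq_add_right sesq_scale_left sesq_scale_right sesq_axis_axis
      algebra_simps)

text \<open>
  Polarization: the imaginary part of the form vanishes at \<open>e\<^sub>i + e\<^sub>j\<close> and at \<open>e\<^sub>i + \<i> e\<^sub>j\<close>.
\<close>
lemma psd_adjoint_entry:
  assumes "psd A" shows "A $ j $ i = cnj (A $ i $ j)"
proof -
  have im: "Im (sesq A v v) = 0" for v
    using assms by (simp add: psd_iff_sesq less_eq_complex_def)
  note s = sesq_add_left sesq_add_right sesq_scale_left sesq_scale_right sesq_axis_axis
  have d: "Im (A $ k $ k) = 0" for k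
    using im[of "axis k 1"] by (simp add: sesq_axis_axis)
  have "Im (A $ i $ j) + Im (A $ j $ i) = 0"
    using im[of "axis i 1 + axis j 1"] d by (simp add: s)
  moreover have "Re (A $ i $ j) - Re (A $ j $ i) = 0"
    using im[of "axis i 1 + \<i> *s axis j 1"] d by (simp add: s)
  ultimately show ?thesis by (simp add: complex_eq_iff)
qed

lemma sesq_diff_rank_one:
  "sesq (A - rank_one w) v v = sesq A v v - of_real ((cmod (\<Sum>i\<in>UNIV. cnj (w $ i) * v $ i))\<^sup>2)"
proof -
  let ?c = "\<Sum>i\<in>UNIV. cnj (w $ i) * v $ i"
  have "sesq (A - rank_one w) v v = sesq A v v - sesq (rank_one w) v v"
    by (simp add: sesq_def algebra_simps sum_subtractf)
  also have "sesq (rank_one w) v v = cnj ?c * ?c"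
    by (simp only: cnj_sum sum_product) (simp add: sesq_def rank_one_def mult_ac)
  also have "\<dots> = of_real ((cmod ?c)\<^sup>2)"
    by (metis complex_norm_square mult.commute)
  finally show ?thesis .
qed

text \<open>
  At \<open>e\<^sub>j - s a e\<^sub>k\<close> with \<open>a = A\<^sub>k\<^sub>j\<close> the form equals \<open>A\<^sub>j\<^sub>j - 2 s |a|\<^sup>2\<close>, which is negative for large \<open>s\<close>
  unless \<open>a = 0\<close>.
\<close>
lemma psd_zero_diagonal:
  assumes A: "psd A" and "A $ k $ k = 0" shows "A $ k $ j = 0"
proof -
  define a where "a = A $ k $ j"
  have jk: "A $ j $ k = cnj a" unfolding a_def by (rule psd_adjoint_entry[OF A])
  have "0 \<le> Re (A $ j $ j) - 2 * s * (cmod a)\<^sup>2" for s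
  proof -
    let ?v = "axis j 1 + (- of_real s * a) *s axis k 1"
    have "sesq A ?v ?v = A $ j $ j - 2 * of_real s * (a * cnj a)"
      using assms(2) unfolding sesq_perturb_axis
      by (simp add: sesq_axis_axis jk a_def[symmetric])
    moreover have "0 \<le> Re (sesq A ?v ?v)"
      using A by (simp add: psd_iff_sesq less_eq_complex_def)
    ultimately show ?thesis by (simp add: cmod_power2 complex_mult_cnj power2_eq_square[symmetric])
  qed
  from this[of "(Re (A $ j $ j) + 1) / (2 * (cmod a)\<^sup>2)"] show ?thesis
    by (cases "a = 0") (auto simp: a_def)
qed

text \<open>
  One step of the Cholesky decomposition.  The matrix left over is the Schur complement of the
  \<open>k\<close>-th diagonal entry.  If that entry is \<open>0\<close>, then \<open>w = 0\<close> by the convention \<open>x / 0 = 0\<close>, which is the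
  right value because the \<open>k\<close>-th row already vanishes.
\<close>
lemma psd_diff_schur:
  fixes k :: "'n::finite"
  assumes A: "psd A"
  defines "w \<equiv> \<chi> i. A $ i $ k / of_real (sqrt (Re (A $ k $ k)))"
  shows "psd (A - rank_one w)" and "(A - rank_one w) $ k $ j = 0"
    and "A $ i $ j = 0 \<Longrightarrow> A $ i $ k = 0 \<Longrightarrow> (A - rank_one w) $ i $ j = 0"
proof -
  define a where "a = Re (A $ k $ k)"
  have "0 \<le> sesq A (axis k 1) (axis k 1)"
    using A by (simp add: psd_iff_sesq)
  then have a: "A $ k $ k = of_real a" "0 \<le> a"
    by (auto simp: sesq_axis_axis a_def less_eq_complex_def complex_eq_iff)
  have adj: "cnj (A $ i $ k) = A $ k $ i" for i
    using psd_adjoint_entry[OF A, of k i] by simp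
  have adj': "A $ i $ k = cnj (A $ k $ i)" for i
    by (rule psd_adjoint_entry[OF A])
  show "psd (A - rank_one w)" unfolding psd_iff_sesq
  proof
    fix v
    define c where "c = (\<Sum>j\<in>UNIV. A $ k $ j * v $ j)"
    have right: "sesq A v (axis k 1) = cnj c"
      by (simp add: sesq_axis_right c_def adj' mult.commute)
    \<comment> \<open>This shift of \<open>v\<close> minimizes the form of \<open>A\<close> along \<open>e\<^sub>k\<close>; the minimum is the Schur complement.\<close>
    let ?v = "v + (- (c / of_real a)) *s axis k 1"
    have "sesq A ?v ?v = sesq A v v - of_real ((cmod c)\<^sup>2 / a)"
      using complex_norm_square[of c]
      unfolding sesq_perturb_axis
      by (cases "a = 0") (simp_all only: sesq_axis_left c_def[symmetric] right, simp_all add: a field_simps)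
    moreover have "(cmod (\<Sum>i\<in>UNIV. cnj (w $ i) * v $ i))\<^sup>2 = (cmod c)\<^sup>2 / a"
      using a(2) by (simp add: w_def a_def[symmetric] adj c_def sum_divide_distrib[symmetric]
          norm_divide power_divide)
    ultimately have "sesq (A - rank_one w) v v = sesq A ?v ?v"
      by (simp add: sesq_diff_rank_one)
    then show "0 \<le> sesq (A - rank_one w) v v"
      using A unfolding psd_iff_sesq by metis
  qed
  show "(A - rank_one w) $ k $ j = 0"
  proof (cases "a = 0")
    case True
    then show ?thesis
      using psd_zero_diagonal[OF A, of k j] a by (simp add: rank_one_def w_def)
  next
    case False
    have "complex_of_real (sqrt a) * of_real (sqrt a) = of_real a"
      using a(2) by (metis of_real_mult real_sqrt_mult_self abs_of_nonneg)
    then show ?thesis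
      using False a by (simp add: rank_one_def w_def adj field_simps)
  qed
  show "A $ i $ j = 0 \<Longrightarrow> A $ i $ k = 0 \<Longrightarrow> (A - rank_one w) $ i $ j = 0"
    by (simp add: rank_one_def w_def)
qed

text \<open>
  Each Schur step clears a further row, so the induction runs over the set of rows that may still be
  nonzero.
\<close>
lemma psd_sum_rank_one_aux:
  assumes "finite S" "psd A" "\<And>i j. i \<notin> S \<Longrightarrow> A $ i $ j = 0"
  shows "\<exists>w. A = (\<Sum>k\<in>S. rank_one (w k))"
  using assms
proof (induction S arbitrary: A rule: finite_induct)
  case empty
  then show ?case by (simp add: vec_eq_iff)
next
  case (insert k S)
  define u where "u = (\<chi> i. A $ i $ k / of_real (sqrt (Re (A $ k $ k))))"
  note schur = psd_diff_schur[OF insert.prems(1), where k=k, folded u_def]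
  have "(A - rank_one u) $ i $ j = 0" if "i \<notin> S" for i j
    using that schur(2) schur(3) insert.prems(2) by (cases "i = k") auto
  then obtain w where w: "A - rank_one u = (\<Sum>k\<in>S. rank_one (w k))"
    using insert.IH[OF schur(1)] by blast
  have "(\<Sum>i\<in>S. rank_one ((w(k := u)) i)) = (\<Sum>i\<in>S. rank_one (w i))"
    using insert.hyps by (intro sum.cong) auto
  then have "A = (\<Sum>i\<in>insert k S. rank_one ((w(k := u)) i))"
    using insert.hyps w by (simp add: algebra_simps)
  then show ?case by blast
qed

lemma psd_sum_rank_one:
  fixes A :: "complex^'n^'n"
  assumes "psd A"
  obtains w :: "'n \<Rightarrow> complex^'n" where "A = (\<Sum>k\<in>UNIV. rank_one (w k))"
  using psd_sum_rank_one_aux[of UNIV, OF _ assms] by auto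

lemma trace_mult_rank_one: "trace (A ** rank_one v) = sesq A v v"
  by (simp add: trace_def matrix_matrix_mult_def rank_one_def sesq_def mult_ac)

lemma sesq_rank_one: "sesq (rank_one v) u u = of_real ((cmod (\<Sum>i\<in>UNIV. cnj (v $ i) * u $ i))\<^sup>2)"
  using sesq_diff_rank_one[of 0 v u] by (simp add: sesq_def sum_negf algebra_simps)

lemma psd_rank_one: "psd (rank_one v)"
  by (simp add: psd_iff_sesq sesq_rank_one less_eq_complex_def)

lemma trace_mult_psd_nonneg:
  fixes A B :: "complex^'n^'n"
  assumes "psd A" "psd B" shows "0 \<le> trace (A ** B)"
proof -
  obtain w :: "'n \<Rightarrow> complex^'n" where w: "B = (\<Sum>k\<in>UNIV. rank_one (w k))"
    using assms(2) by (rule psd_sum_rank_one)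
  have "trace (A ** B) = (\<Sum>k\<in>UNIV. trace (A ** rank_one (w k)))"
  proof -
    have "trace (A ** B) = (\<Sum>i\<in>UNIV. \<Sum>j\<in>UNIV. \<Sum>k\<in>UNIV. A $ i $ j * rank_one (w k) $ j $ i)"
      by (simp add: w trace_def matrix_matrix_mult_def sum_distrib_left)
    also have "\<dots> = (\<Sum>i\<in>UNIV. \<Sum>k\<in>UNIV. \<Sum>j\<in>UNIV. A $ i $ j * rank_one (w k) $ j $ i)"
      by (intro sum.cong refl sum.swap)
    also have "\<dots> = (\<Sum>k\<in>UNIV. \<Sum>i\<in>UNIV. \<Sum>j\<in>UNIV. A $ i $ j * rank_one (w k) $ j $ i)"
      by (rule sum.swap)
    finally show ?thesis by (simp add: trace_def matrix_matrix_mult_def)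
  qed
  then show ?thesis
    using assms(1) by (simp add: trace_mult_rank_one psd_iff_sesq sum_nonneg)
qed

section \<open>Positive maps and the Choi correspondence\<close>

lemma sum_swap_pairs:
  "(\<Sum>a\<in>A. \<Sum>b\<in>B. \<Sum>c\<in>C. \<Sum>d\<in>D. f a b c d) =
   (\<Sum>c\<in>C. \<Sum>d\<in>D. \<Sum>a\<in>A. \<Sum>b\<in>B. f a b c d)"
proof -
  have "(\<Sum>a\<in>A. \<Sum>b\<in>B. \<Sum>c\<in>C. \<Sum>d\<in>D. f a b c d) =
      (\<Sum>x\<in>A\<times>B. \<Sum>y\<in>C\<times>D. f (fst x) (snd x) (fst y) (snd y))"
    by (simp add: sum.cartesian_product')
  also have "\<dots> = (\<Sum>y\<in>C\<times>D. \<Sum>x\<in>A\<times>B. f (fst x) (snd x) (fst y) (snd y))"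
    by (rule sum.swap)
  finally show ?thesis by (simp add: sum.cartesian_product')
qed

lemma linear_map_sum:
  assumes "linear_map \<phi>" shows "\<phi> (\<Sum>k\<in>S. f k) = (\<Sum>k\<in>S. \<phi> (f k))"
proof -
  interpret l: Vector_Spaces.linear cscale cscale \<phi> by fact
  show ?thesis by (rule l.sum)
qed

lemma linear_map_compose: "linear_map \<phi> \<Longrightarrow> linear_map \<psi> \<Longrightarrow> linear_map (\<phi> \<circ> \<psi>)"
  by (simp add: linear_map_iff)

lemma sesq_add: "sesq (A + B) u v = sesq A u v + sesq B u v"
  by (simp add: sesq_def algebra_simps sum.distrib)

lemma sesq_sum: "sesq (\<Sum>k\<in>S. A k) u v = (\<Sum>k\<in>S. sesq (A k) u v)"
  by (induction S rule: infinite_finite_induct) (simp_all add: sesq_add, simp_all add: sesq_def)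

lemma sesq_cscale: "sesq (cscale c A) u v = c * sesq A u v"
  by (simp add: sesq_def cscale_def sum_distrib_left mult_ac)

lemma sesq_munit: "sesq (munit i j) u v = cnj (u $ i) * v $ j"
proof -
  have "sesq (munit i j) u v =
      (\<Sum>k\<in>UNIV. if k = i then (\<Sum>l\<in>UNIV. if l = j then cnj (u $ k) * v $ l else 0) else 0)"
    unfolding sesq_def munit_def
    by (intro sum.cong refl) (simp add: if_distrib[of "(*) _"] if_distrib[of "\<lambda>x. x * _"] cong: if_cong)
  then show ?thesis by simp
qed

lemma linear_functional_sesq: "linear_functional (\<lambda>a. sesq a u v)"
  by (simp add: linear_functional_iff sesq_add sesq_cscale)

lemma positive_mapsI:
  fixes \<phi> :: "complex^'n^'n \<Rightarrow> complex^'n^'n"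
  assumes lin: "linear_map \<phi>" and pos: "\<And>w v. 0 \<le> sesq (\<phi> (rank_one w)) v v"
  shows "\<phi> \<in> positive_maps"
proof -
  have "psd (\<phi> a)" if a: "psd a" for a
  proof -
    obtain w :: "'n \<Rightarrow> complex^'n" where w: "a = (\<Sum>k\<in>UNIV. rank_one (w k))"
      using a by (rule psd_sum_rank_one)
    show ?thesis
      unfolding psd_iff_sesq w linear_map_sum[OF lin] sesq_sum
      by (intro allI sum_nonneg pos)
  qed
  then show ?thesis using lin by (simp add: positive_maps_def)
qed

lemma choi_nth: "choi \<phi> $ p $ q = \<phi> (munit (fst p) (fst q)) $ snd p $ snd q"
proof -
  have "choi \<phi> $ p $ q = (\<Sum>i\<in>UNIV. \<Sum>j\<in>UNIV.
      (if fst p = i \<and> fst q = j then 1 else 0) * \<phi> (munit i j) $ snd p $ snd q)"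
    by (simp add: choi_def kron_def munit_def)
  also have "\<dots> = (\<Sum>i\<in>UNIV. if fst p = i then (\<Sum>j\<in>UNIV. if fst q = j
      then \<phi> (munit i j) $ snd p $ snd q else 0) else 0)"
    by (intro sum.cong refl) (simp add: if_distrib[of "\<lambda>x. x * _"] cong: if_cong)
  finally show ?thesis by simp
qed

text \<open>
  The inverse of the correspondence \<open>\<phi> \<mapsto> C\<^sub>\<phi>\<close>.
\<close>
definition choi_map :: "complex^('n \<times> 'n)^('n \<times> 'n) \<Rightarrow> complex^'n^'n \<Rightarrow> complex^'n^'n" where
  "choi_map B a = (\<chi> s t. \<Sum>i\<in>UNIV. \<Sum>j\<in>UNIV. a $ i $ j * B $ (i, s) $ (j, t))"

lemma linear_choi_map: "linear_map (choi_map B)"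
  by (simp add: linear_map_iff choi_map_def cscale_def vec_eq_iff algebra_simps sum.distrib
      sum_distrib_left)

lemma choi_map_choi:
  assumes "linear_map \<phi>" shows "choi_map (choi \<phi>) = \<phi>"
proof
  fix a
  show "choi_map (choi \<phi>) a = \<phi> a"
    by (subst linear_expand[OF assms])
       (simp add: vec_eq_iff choi_map_def choi_nth cscale_def)
qed

lemma choi_choi_map: "choi (choi_map B) = B"
proof -
  have "(\<Sum>i\<in>UNIV. \<Sum>j\<in>UNIV. munit k l $ i $ j * B $ (i, s) $ (j, t)) = B $ (k, s) $ (l, t)"
    for k l s t
  proof -
    have "(\<Sum>i\<in>UNIV. \<Sum>j\<in>UNIV. munit k l $ i $ j * B $ (i, s) $ (j, t)) =
      (\<Sum>i\<in>UNIV. if i = k then (\<Sum>j\<in>UNIV. if j = l then B $ (i, s) $ (j, t) else 0) else 0)"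
      unfolding munit_def
      by (intro sum.cong refl) (simp add: if_distrib[of "\<lambda>x. x * _"] cong: if_cong)
    then show ?thesis by simp
  qed
  then show ?thesis by (simp add: vec_eq_iff choi_nth choi_map_def)
qed

lemma choi_inject: "linear_map \<phi> \<Longrightarrow> linear_map \<psi> \<Longrightarrow> choi \<phi> = choi \<psi> \<Longrightarrow> \<phi> = \<psi>"
  by (metis choi_map_choi)

text \<open>
  The form of \<open>C\<^sub>\<phi>\<close> is the block form of \<open>(\<phi>(e\<^sub>i\<^sub>j))\<^sub>i\<^sub>j\<close> evaluated at the blocks of the two vectors.
\<close>
lemma sesq_choi:
  "sesq (choi \<phi>) u v =
    (\<Sum>i\<in>UNIV. \<Sum>j\<in>UNIV. sesq (\<phi> (munit i j)) (\<chi> s. u $ (i, s)) (\<chi> t. v $ (j, t)))"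
  using sum_kron[of "\<lambda>i s j t. cnj (u $ (i, s)) * \<phi> (munit i j) $ s $ t * v $ (j, t)"]
  by (simp add: sesq_def choi_nth)

section \<open>Complete positivity and Choi's theorem\<close>

lemma block_psd_iff:
  "block_psd k A \<longleftrightarrow> (\<forall>v. 0 \<le> (\<Sum>p<k. \<Sum>q<k. sesq (A p q) (v p) (v q)))"
  by (simp add: block_psd_def sesq_def)

lemma completely_positive_sum:
  assumes cp: "\<And>k. k \<in> S \<Longrightarrow> f k \<in> completely_positive_maps"
  shows "(\<lambda>a. \<Sum>k\<in>S. f k a) \<in> completely_positive_maps"
proof -
  have lin: "linear_map (f k)" if "k \<in> S" for k
    using cp[OF that] by (simp add: completely_positive_maps_def)
  have "linear_map (\<lambda>a. \<Sum>k\<in>S. f k a)"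
    unfolding linear_map_iff using lin
    by (simp add: linear_map_iff sum.distrib[symmetric])
       (simp add: cscale_def vec_eq_iff sum_distrib_left)
  moreover have "block_psd n (\<lambda>p q. \<Sum>k\<in>S. f k (A p q))" if "block_psd n A" for n A
    unfolding block_psd_iff
  proof
    fix v
    have "(\<Sum>p<n. \<Sum>q<n. sesq (\<Sum>k\<in>S. f k (A p q)) (v p) (v q)) =
        (\<Sum>p<n. \<Sum>k\<in>S. \<Sum>q<n. sesq (f k (A p q)) (v p) (v q))"
      unfolding sesq_sum by (intro sum.cong refl sum.swap)
    also have "\<dots> = (\<Sum>k\<in>S. \<Sum>p<n. \<Sum>q<n. sesq (f k (A p q)) (v p) (v q))"
      by (rule sum.swap)
    also have "0 \<le> \<dots>"
    proof (rule sum_nonneg)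
      fix k assume "k \<in> S"
      then have "block_psd n (\<lambda>p q. f k (A p q))"
        using cp that by (simp add: completely_positive_maps_def)
      then show "0 \<le> (\<Sum>p<n. \<Sum>q<n. sesq (f k (A p q)) (v p) (v q))"
        unfolding block_psd_iff by blast
    qed
    finally show "0 \<le> (\<Sum>p<n. \<Sum>q<n. sesq (\<Sum>k\<in>S. f k (A p q)) (v p) (v q))" .
  qed
  ultimately show ?thesis by (simp add: completely_positive_maps_def)
qed

text \<open>
  A Choi matrix of rank one belongs to a single Kraus operator: the map is \<open>a \<mapsto> W\<^sup>* a W\<close> with \<open>W\<close> the
  matrix of the conjugated coordinates of \<open>w\<close>, so applying it to a block matrix amounts to applying \<open>W\<close> to each block
  of the vector.
\<close>
lemma completely_positive_choi_map_rank_one: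
  fixes w :: "complex^('n::finite \<times> 'n)"
  shows "choi_map (rank_one w) \<in> completely_positive_maps"
proof -
  define W where "W u = (\<chi> i. \<Sum>s\<in>UNIV. cnj (w $ (i, s)) * u $ s)" for u :: "complex^'n"
  have "sesq (choi_map (rank_one w) a) u v = sesq a (W u) (W v)" for a u v
  proof -
    have "sesq (choi_map (rank_one w) a) u v = (\<Sum>s\<in>UNIV. \<Sum>t\<in>UNIV. \<Sum>i\<in>UNIV. \<Sum>j\<in>UNIV.
        w $ (i, s) * cnj (u $ s) * (a $ i $ j * (cnj (w $ (j, t)) * v $ t)))"
      by (simp add: sesq_def choi_map_def rank_one_def sum_distrib_left sum_distrib_right mult_ac)
    also have "\<dots> = (\<Sum>i\<in>UNIV. \<Sum>j\<in>UNIV. \<Sum>s\<in>UNIV. \<Sum>t\<in>UNIV.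
        w $ (i, s) * cnj (u $ s) * (a $ i $ j * (cnj (w $ (j, t)) * v $ t)))"
      by (rule sum_swap_pairs)
    also have "\<dots> = (\<Sum>i\<in>UNIV. \<Sum>j\<in>UNIV. (\<Sum>s\<in>UNIV. w $ (i, s) * cnj (u $ s)) *
        (\<Sum>t\<in>UNIV. a $ i $ j * (cnj (w $ (j, t)) * v $ t)))"
      by (simp only: sum_product)
    also have "\<dots> = sesq a (W u) (W v)"
      by (simp add: sesq_def W_def sum_distrib_left[symmetric] mult.assoc)
    finally show ?thesis .
  qed
  then show ?thesis
    by (simp add: completely_positive_maps_def linear_choi_map block_psd_iff)
qed

text \<open>
  Choi's theorem.  If the Choi matrix is positive semidefinite, its rank-one summands give a Kraus
  decomposition.  Conversely the Choi matrix is the image of the block matrix \<open>(e\<^sub>i\<^sub>j)\<^sub>i\<^sub>j\<close>, which is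
  positive semidefinite.
\<close>
lemma completely_positive_iff_psd_choi:
  fixes \<phi> :: "complex^'n^'n \<Rightarrow> complex^'n^'n"
  assumes lin: "linear_map \<phi>"
  shows "\<phi> \<in> completely_positive_maps \<longleftrightarrow> psd (choi \<phi>)"
proof
  assume psd: "psd (choi \<phi>)"
  obtain w :: "'n \<times> 'n \<Rightarrow> complex^('n \<times> 'n)"
    where w: "choi \<phi> = (\<Sum>k\<in>UNIV. rank_one (w k))"
    using psd by (rule psd_sum_rank_one)
  have "\<phi> a = (\<Sum>k\<in>UNIV. choi_map (rank_one (w k)) a)" for a
  proof -
    have "choi_map (choi \<phi>) a $ s $ t = (\<Sum>k\<in>UNIV. choi_map (rank_one (w k)) a) $ s $ t" for s t
    proof -
      have "choi_map (choi \<phi>) a $ s $ t =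
          (\<Sum>i\<in>UNIV. \<Sum>j\<in>UNIV. \<Sum>k\<in>UNIV. a $ i $ j * rank_one (w k) $ (i, s) $ (j, t))"
        unfolding w by (simp add: choi_map_def sum_distrib_left)
      also have "\<dots> = (\<Sum>i\<in>UNIV. \<Sum>k\<in>UNIV. \<Sum>j\<in>UNIV. a $ i $ j * rank_one (w k) $ (i, s) $ (j, t))"
        by (intro sum.cong refl sum.swap)
      also have "\<dots> = (\<Sum>k\<in>UNIV. \<Sum>i\<in>UNIV. \<Sum>j\<in>UNIV. a $ i $ j * rank_one (w k) $ (i, s) $ (j, t))"
        by (rule sum.swap)
      finally show ?thesis by (simp add: choi_map_def)
    qed
    then show ?thesis by (simp add: choi_map_choi[OF lin] vec_eq_iff)
  qed
  then have eq: "\<phi> = (\<lambda>a. \<Sum>k\<in>UNIV. choi_map (rank_one (w k)) a)" by (rule ext)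
  show "\<phi> \<in> completely_positive_maps"
    unfolding eq
    by (rule completely_positive_sum[where f = "\<lambda>k. choi_map (rank_one (w k))"])
       (rule completely_positive_choi_map_rank_one)
next
  assume cp: "\<phi> \<in> completely_positive_maps"
  obtain h where h: "bij_betw h {..<CARD('n)} (UNIV :: 'n set)"
    using ex_bij_betw_nat_finite[of "UNIV :: 'n set"] by (auto simp: atLeast0LessThan)
  have "block_psd CARD('n) (\<lambda>p q. munit (h p) (h q))"
    unfolding block_psd_iff
  proof
    fix v :: "nat \<Rightarrow> complex^'n"
    let ?c = "\<Sum>p<CARD('n). v p $ h p"
    have "(\<Sum>p<CARD('n). \<Sum>q<CARD('n). sesq (munit (h p) (h q)) (v p) (v q)) = cnj ?c * ?c"
      by (simp only: sesq_munit cnj_sum sum_product)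
    also have "\<dots> = of_real ((cmod ?c)\<^sup>2)"
      by (metis complex_norm_square mult.commute)
    finally show "0 \<le> (\<Sum>p<CARD('n). \<Sum>q<CARD('n). sesq (munit (h p) (h q)) (v p) (v q))"
      by (simp add: less_eq_complex_def)
  qed
  then have block: "block_psd CARD('n) (\<lambda>p q. \<phi> (munit (h p) (h q)))"
    using cp by (auto simp: completely_positive_maps_def)
  show "psd (choi \<phi>)"
    unfolding psd_iff_sesq
  proof
    fix z
    let ?f = "\<lambda>i j. sesq (\<phi> (munit i j)) (\<chi> s. z $ (i, s)) (\<chi> t. z $ (j, t))"
    have "sesq (choi \<phi>) z z = (\<Sum>p<CARD('n). \<Sum>q<CARD('n). ?f (h p) (h q))"
      by (simp add: sesq_choi sum.reindex_bij_betw[OF h, of "?f i" for i]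
          sum.reindex_bij_betw[OF h, of "\<lambda>i. \<Sum>j\<in>UNIV. ?f i j"])
    then show "0 \<le> sesq (choi \<phi>) z z"
      using block[unfolded block_psd_iff, rule_format, of "\<lambda>p. \<chi> s. z $ (h p, s)"] by simp
  qed
qed

lemma completely_positive_imp_positive:
  assumes cp: "\<phi> \<in> completely_positive_maps" shows "\<phi> \<in> positive_maps"
proof -
  have "psd (\<phi> a)" if "psd a" for a
  proof -
    have cp_block: "block_psd k A \<Longrightarrow> block_psd k (\<lambda>p q. \<phi> (A p q))" for k A
      using cp by (simp add: completely_positive_maps_def)
    have "block_psd 1 (\<lambda>p q. a)" using that by (simp add: block_psd_iff psd_iff_sesq)
    from cp_block[OF this] have "0 \<le> sesq (\<phi> a) v v" for v
      unfolding block_psd_iff by (auto dest: spec[where x = "\<lambda>_. v"])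
    then show ?thesis by (simp add: psd_iff_sesq)
  qed
  then show ?thesis using cp by (simp add: positive_maps_def completely_positive_maps_def)
qed

section \<open>Adjoints and the operator trace\<close>

lemma trace_adjoint:
  assumes "linear_map \<phi>" shows "trace (a ** trace_adjoint \<phi> b) = trace (\<phi> a ** b)"
  using theI'[OF ex1_trace_adjoint[OF assms], folded trace_adjoint_def] by simp

lemma trace_adjoint_eqI:
  assumes "\<And>a b. trace (\<phi> a ** b) = trace (a ** \<psi> b)" "linear_map \<phi>"
  shows "trace_adjoint \<phi> = \<psi>"
  unfolding trace_adjoint_def by (intro the1_equality ex1_trace_adjoint assms allI)

lemma trace_adjoint_nth:
  "linear_map \<phi> \<Longrightarrow> trace_adjoint \<phi> b $ j $ i = trace (\<phi> (munit i j) ** b)"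
  using trace_adjoint[of \<phi> "munit i j" b] by (simp add: trace_munit_mult)

lemma linear_trace_adjoint:
  fixes \<phi> :: "complex^'n^'n \<Rightarrow> complex^'n^'n"
  assumes "linear_map \<phi>" shows "linear_map (trace_adjoint \<phi>)"
proof -
  have "linear_functional (\<lambda>b. trace (c ** b))" for c :: "complex^'n^'n"
  proof -
    have "linear_functional (\<lambda>b. trace (b ** c))"
      by (rule linear_trace_mult) (simp add: linear_map_iff)
    then show ?thesis by (simp only: trace_mul_sym[of _ c])
  qed
  then show ?thesis
    by (simp add: linear_map_iff linear_functional_iff vec_eq_iff trace_adjoint_nth[OF assms])
       (simp add: trace_adjoint_nth[OF assms] cscale_def)
qed

lemma trace_adjoint_trace_adjoint:
  assumes lin: "linear_map \<phi>" shows "trace_adjoint (trace_adjoint \<phi>) = \<phi>"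
proof (rule trace_adjoint_eqI[OF _ linear_trace_adjoint[OF lin]])
  fix a b
  show "trace (trace_adjoint \<phi> a ** b) = trace (a ** \<phi> b)"
    using trace_adjoint[OF lin, of b a] by (simp only: trace_mul_sym[of _ b] trace_mul_sym[of a])
qed

text \<open>
  The trace pairing of positive semidefinite matrices is nonnegative, and the form of
  \<open>\<phi>\<^sup>*(b)\<close> at \<open>v\<close> is the pairing of \<open>b\<close> with \<open>\<phi>(v v\<^sup>*)\<close>.
\<close>
lemma trace_adjoint_positive:
  assumes \<phi>: "\<phi> \<in> positive_maps" shows "trace_adjoint \<phi> \<in> positive_maps"
proof -
  have lin: "linear_map \<phi>" using \<phi> by (simp add: positive_maps_def)
  show ?thesis
  proof (rule positive_mapsI[OF linear_trace_adjoint[OF lin]])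
    fix w v
    have "sesq (trace_adjoint \<phi> (rank_one w)) v v = trace (\<phi> (rank_one v) ** rank_one w)"
      unfolding trace_mult_rank_one[symmetric] trace_adjoint[OF lin, symmetric]
      by (rule trace_mul_sym)
    then show "0 \<le> sesq (trace_adjoint \<phi> (rank_one w)) v v"
      using \<phi> by (simp add: trace_mult_psd_nonneg psd_rank_one positive_maps_def)
  qed
qed

text \<open>
  The trace of \<open>\<phi>\<close> as a linear operator on \<open>M\<^sub>n\<close>, computed in the basis of matrix units.
\<close>
definition map_trace :: "(complex^'n^'n \<Rightarrow> complex^'n^'n) \<Rightarrow> complex" where
  "map_trace \<phi> = (\<Sum>i\<in>UNIV. \<Sum>j\<in>UNIV. \<phi> (munit i j) $ i $ j)"

lemma map_trace_commute:
  assumes "linear_map \<phi>" "linear_map \<psi>"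
  shows "map_trace (\<phi> \<circ> \<psi>) = map_trace (\<psi> \<circ> \<phi>)"
proof -
  have expand: "map_trace (\<phi> \<circ> \<psi>) = (\<Sum>i\<in>UNIV. \<Sum>j\<in>UNIV. \<Sum>k\<in>UNIV. \<Sum>l\<in>UNIV.
      \<psi> (munit i j) $ k $ l * \<phi> (munit k l) $ i $ j)" if "linear_map \<phi>" for \<phi> \<psi>
    by (simp add: map_trace_def linear_expand[OF that, of "\<psi> _"] cscale_def)
  show ?thesis
    unfolding expand[OF assms(1)] expand[OF assms(2)]
    by (subst sum_swap_pairs) (simp add: mult.commute)
qed

text \<open>
  The left side is \<open>\<Sum>\<^sub>i\<^sub>j Tr(\<phi>(e\<^sub>i\<^sub>j) \<psi>(e\<^sub>j\<^sub>i))\<close>; moving \<open>\<psi>\<close> across the trace pairing turns each term into the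
  coefficient of \<open>\<psi>\<^sup>*(\<phi>(e\<^sub>i\<^sub>j))\<close> at \<open>e\<^sub>i\<^sub>j\<close>.
\<close>
lemma trace_choi_mult:
  assumes "linear_map \<psi>"
  shows "trace (choi \<phi> ** choi \<psi>) = map_trace (trace_adjoint \<psi> \<circ> \<phi>)"
proof -
  have "trace (choi \<phi> ** choi \<psi>) = (\<Sum>i\<in>UNIV. \<Sum>j\<in>UNIV. \<Sum>k\<in>UNIV. \<Sum>l\<in>UNIV.
      \<phi> (munit i j) $ k $ l * \<psi> (munit j i) $ l $ k)"
    using sum_kron[of "\<lambda>i k j l. \<phi> (munit i j) $ k $ l * \<psi> (munit j i) $ l $ k"]
    by (simp add: trace_def matrix_matrix_mult_def choi_nth)
  also have "\<dots> = (\<Sum>i\<in>UNIV. \<Sum>j\<in>UNIV. trace (\<phi> (munit i j) ** \<psi> (munit j i)))"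
    by (simp add: trace_def matrix_matrix_mult_def)
  also have "\<dots> = map_trace (trace_adjoint \<psi> \<circ> \<phi>)"
    by (simp add: map_trace_def trace_adjoint_nth[OF assms] trace_mul_sym[of "\<phi> _"])
  finally show ?thesis .
qed

text \<open>
  The operator trace is the form of the Choi matrix at the unnormalized maximally entangled vector.
\<close>
lemma map_trace_nonneg:
  fixes \<phi> :: "complex^'n^'n \<Rightarrow> complex^'n^'n"
  assumes "\<phi> \<in> completely_positive_maps" shows "0 \<le> map_trace \<phi>"
proof -
  have lin: "linear_map \<phi>" using assms by (simp add: completely_positive_maps_def)
  let ?d = "\<chi> p. if fst p = snd p then 1 else 0"
  have d: "(\<chi> s. (?d :: complex^('n\<times>'n)) $ (i, s)) = axis i 1" for i
    by (auto simp: axis_def vec_eq_iff)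
  have "map_trace \<phi> = sesq (choi \<phi>) ?d ?d"
    unfolding sesq_choi d sesq_axis_axis by (simp add: map_trace_def)
  then show ?thesis
    using assms by (simp add: completely_positive_iff_psd_choi[OF lin] psd_iff_sesq)
qed

section \<open>The separable cone\<close>

definition product_vector :: "complex^'n \<Rightarrow> complex^'n \<Rightarrow> complex^('n \<times> 'n)" where
  "product_vector x y = (\<chi> p. x $ fst p * y $ snd p)"

definition pure_products :: "(complex^('n \<times> 'n)^('n::finite \<times> 'n)) set" where
  "pure_products = (\<lambda>(x, y). rank_one (product_vector x y)) ` (sphere 0 1 \<times> sphere 0 1)"

lemma norm_eq_1_iff: "norm (x :: complex^'n) = 1 \<longleftrightarrow> (\<Sum>i\<in>UNIV. x $ i * cnj (x $ i)) = 1"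
proof -
  have "(\<Sum>i\<in>UNIV. x $ i * cnj (x $ i)) = of_real ((norm x)\<^sup>2)"
    by (simp add: complex_norm_square[symmetric] norm_vec_def L2_set_def sum_nonneg)
  then show ?thesis
    by (simp add: power2_eq_1_iff of_real_eq_1_iff del: of_real_power) (smt (verit) norm_ge_zero)
qed

lemma trace_rank_one: "trace (rank_one v) = (\<Sum>i\<in>UNIV. v $ i * cnj (v $ i))"
  by (simp add: trace_def rank_one_def)

text \<open>
  The normalization that keeps the generators away from \<open>0\<close>.
\<close>
lemma trace_pure_products: "X \<in> pure_products \<Longrightarrow> trace X = 1"
proof -
  assume "X \<in> pure_products"
  then obtain x y where X: "X = rank_one (product_vector x y)" and n: "norm x = 1" "norm y = 1"
    by (auto simp: pure_products_def)
  have "trace X = (\<Sum>i\<in>UNIV. \<Sum>s\<in>UNIV. (x $ i * cnj (x $ i)) * (y $ s * cnj (y $ s)))"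
    using sum_UNIV_pairs[of "\<lambda>i s. (x $ i * cnj (x $ i)) * (y $ s * cnj (y $ s))"]
    by (simp add: X trace_rank_one product_vector_def mult_ac)
  also have "\<dots> = (\<Sum>i\<in>UNIV. x $ i * cnj (x $ i)) * (\<Sum>s\<in>UNIV. y $ s * cnj (y $ s))"
    by (rule sum_product[symmetric])
  also have "\<dots> = 1"
    using n by (simp only: norm_eq_1_iff mult_1)
  finally show ?thesis .
qed

lemma compact_pure_products: "compact (pure_products :: (complex^('n::finite \<times> 'n)^('n \<times> 'n)) set)"
  unfolding pure_products_def
proof (rule compact_continuous_image)
  show "compact (sphere 0 1 \<times> sphere 0 1 :: ((complex^'n) \<times> (complex^'n)) set)"
    by (intro compact_Times compact_sphere)
  show "continuous_on (sphere 0 1 \<times> sphere 0 1)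
      (\<lambda>(x, y). rank_one (product_vector x (y :: complex^'n)))"
    unfolding rank_one_def product_vector_def case_prod_beta
    by (simp, intro continuous_on_vec_lambda continuous_intros)
qed

definition separable_cone :: "(complex^('n \<times> 'n)^('n::finite \<times> 'n)) set" where
  "separable_cone = conic hull (convex hull pure_products)"

lemma convex_separable_cone: "convex separable_cone"
  unfolding separable_cone_def by (intro convex_conic_hull convex_convex_hull)

text \<open>
  A cone generated by a compact convex set is closed if the set misses the origin; here the trace is
  \<open>1\<close> on the whole hull.
\<close>
lemma closed_separable_cone: "closed (separable_cone :: (complex^('n::finite \<times> 'n)^('n \<times> 'n)) set)"
proof -
  have "convex hull pure_products \<subseteq> {X :: complex^('n \<times> 'n)^('n \<times> 'n). Re (trace X) = 1}"
  proof (rule hull_minimal)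
    show "pure_products \<subseteq> {X :: complex^('n \<times> 'n)^('n \<times> 'n). Re (trace X) = 1}"
      using trace_pure_products by force
    have "trace (u *\<^sub>R X + v *\<^sub>R Y) = u *\<^sub>R trace X + v *\<^sub>R trace Y" for u v and X Y :: "complex^('n \<times> 'n)^('n \<times> 'n)"
      by (simp add: trace_def sum.distrib scaleR_sum_right)
    then show "convex {X :: complex^('n \<times> 'n)^('n \<times> 'n). Re (trace X) = 1}"
      by (auto simp: convex_def)
  qed
  moreover have "trace (0 :: complex^('n \<times> 'n)^('n \<times> 'n)) = 0" by (simp add: trace_def)
  ultimately have "(0 :: complex^('n \<times> 'n)^('n \<times> 'n)) \<notin> convex hull pure_products"
    by (auto dest!: subsetD[of _ _ 0])
  then show ?thesis
    unfolding separable_cone_def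
    by (intro closed_conic_hull_strong disjI2 conjI compact_convex_hull compact_pure_products)
qed

lemma separable_cone_scale: "X \<in> separable_cone \<Longrightarrow> 0 \<le> c \<Longrightarrow> c *\<^sub>R X \<in> separable_cone"
  unfolding separable_cone_def by (rule conicD[OF conic_conic_hull])

lemma rank_one_product_in_separable_cone:
  fixes x y :: "complex^'n"
  shows "rank_one (product_vector x y) \<in> separable_cone"
proof -
  have sub: "pure_products \<subseteq> separable_cone"
    unfolding separable_cone_def by (meson hull_subset subset_trans)
  \<comment> \<open>The value at \<open>0\<close> is an arbitrary unit vector.\<close>
  define u where "u z = (if z = 0 then axis undefined 1 else z /\<^sub>R norm z)" for z :: "complex^'n"
  have u: "norm (u z) = 1" "z = norm z *\<^sub>R u z" for z
    by (auto simp: u_def)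
  have "rank_one (product_vector (a *\<^sub>R x') (b *\<^sub>R y')) = (a * b)\<^sup>2 *\<^sub>R rank_one (product_vector x' y')"
    for a b and x' y' :: "complex^'n"
    by (simp add: vec_eq_iff rank_one_def product_vector_def scaleR_conv_of_real[where 'a = complex] power2_eq_square)
  from this[of "norm x" "u x" "norm y" "u y"]
  have "rank_one (product_vector x y) = (norm x * norm y)\<^sup>2 *\<^sub>R rank_one (product_vector (u x) (u y))"
    by (simp only: u(2)[symmetric])
  moreover have "rank_one (product_vector (u x) (u y)) \<in> separable_cone"
  proof (rule subsetD[OF sub])
    show "rank_one (product_vector (u x) (u y)) \<in> pure_products"
      unfolding pure_products_def by (rule image_eqI[of _ _ "(u x, u y)"]) (simp_all add: u(1))
  qed
  ultimately show ?thesis by (simp add: separable_cone_scale)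
qed

section \<open>Super-positive maps\<close>

lemma super_positive_linear:
  fixes \<phi> :: "complex^'n^'n \<Rightarrow> complex^'n^'n"
  assumes "\<phi> \<in> super_positive_maps" shows "linear_map \<phi>"
proof -
  obtain m \<omega> a where \<phi>: "\<phi> = (\<lambda>x. \<Sum>i<(m::nat). cscale (\<omega> i x) (a i))" and "\<And>i. i < m \<Longrightarrow> state (\<omega> i)"
    using assms by (auto simp: super_positive_maps_def)
  then have "\<omega> i (x + y) = \<omega> i x + \<omega> i y" "\<omega> i (cscale c x) = c * \<omega> i x" if "i < m" for i x y c
    using that by (simp_all add: state_def positive_functional_def linear_functional_iff)
  then have "(\<Sum>i<m. cscale (\<omega> i (x + y)) (a i)) =
      (\<Sum>i<m. cscale (\<omega> i x) (a i) + cscale (\<omega> i y) (a i))"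
    "(\<Sum>i<m. cscale (\<omega> i (cscale c x)) (a i)) =
      (\<Sum>i<m. cscale c (cscale (\<omega> i x) (a i)))" for x y c
    by (auto intro!: sum.cong simp: cscale_def vec_eq_iff algebra_simps)
  then show ?thesis
    by (simp add: \<phi> linear_map_iff sum.distrib)
       (simp add: vec_eq_iff cscale_def sum_distrib_left)
qed

lemma super_positive_add:
  fixes \<phi> \<psi> :: "complex^'n^'n \<Rightarrow> complex^'n^'n"
  assumes "\<phi> \<in> super_positive_maps" "\<psi> \<in> super_positive_maps"
  shows "(\<lambda>x. \<phi> x + \<psi> x) \<in> super_positive_maps"
proof -
  obtain m \<omega> a where 1: "\<phi> = (\<lambda>x. \<Sum>i<(m::nat). cscale (\<omega> i x) (a i))"
      "\<And>i. i < m \<Longrightarrow> state (\<omega> i) \<and> psd (a i)"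
    using assms(1) by (auto simp: super_positive_maps_def)
  obtain m' \<omega>' a' where 2: "\<psi> = (\<lambda>x. \<Sum>i<(m'::nat). cscale (\<omega>' i x) (a' i))"
      "\<And>i. i < m' \<Longrightarrow> state (\<omega>' i) \<and> psd (a' i)"
    using assms(2) by (auto simp: super_positive_maps_def)
  define \<theta> where "\<theta> i = (if i < m then \<omega> i else \<omega>' (i - m))" for i
  define b where "b i = (if i < m then a i else a' (i - m))" for i
  have split: "(\<Sum>i<m + k. f i) = (\<Sum>i<m. f i) + (\<Sum>i<k. f (m + i))"
    for f :: "nat \<Rightarrow> complex^'n^'n" and k
    by (induction k) (simp_all add: add.assoc)
  have "(\<lambda>x. \<phi> x + \<psi> x) = (\<lambda>x. \<Sum>i<m + m'. cscale (\<theta> i x) (b i))"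
    by (simp add: 1(1) 2(1) split \<theta>_def b_def)
  moreover have "state (\<theta> i) \<and> psd (b i)" if "i < m + m'" for i
    using 1(2) 2(2) that by (auto simp: \<theta>_def b_def)
  ultimately show ?thesis
    unfolding super_positive_maps_def by blast
qed

lemma super_positive_scale:
  fixes \<phi> :: "complex^'n^'n \<Rightarrow> complex^'n^'n"
  assumes "\<phi> \<in> super_positive_maps" "0 \<le> c"
  shows "(\<lambda>x. c *\<^sub>R \<phi> x) \<in> super_positive_maps"
proof -
  obtain m \<omega> a where 1: "\<phi> = (\<lambda>x. \<Sum>i<(m::nat). cscale (\<omega> i x) (a i))"
      "\<And>i. i < m \<Longrightarrow> state (\<omega> i) \<and> psd (a i)"
    using assms(1) by (auto simp: super_positive_maps_def)
  have "c *\<^sub>R cscale z A = cscale z (c *\<^sub>R A)" for z and A :: "complex^'n^'n"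
    by (simp add: cscale_def vec_eq_iff)
  then have "(\<lambda>x. c *\<^sub>R \<phi> x) = (\<lambda>x. \<Sum>i<m. cscale (\<omega> i x) (c *\<^sub>R a i))"
    by (simp only: 1(1) scaleR_sum_right)
  moreover have "state (\<omega> i) \<and> psd (c *\<^sub>R a i)" if "i < m" for i
  proof -
    have "c *\<^sub>R a i = cscale (of_real c) (a i)"
      by (simp add: cscale_def vec_eq_iff scaleR_conv_of_real[where 'a = complex])
    then show ?thesis
      using 1(2)[OF that] assms(2) by (auto simp: psd_iff_sesq sesq_cscale less_eq_complex_def)
  qed
  ultimately show ?thesis
    unfolding super_positive_maps_def
    by (intro CollectI exI[of _ m] exI[of _ \<omega>] exI[of _ "\<lambda>i. c *\<^sub>R a i"]) blast
qed

text \<open>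
  The matrix \<open>z z\<^sup>*\<close> for \<open>z = x \<otimes> y\<close> is the Choi matrix of \<open>a \<mapsto> \<omega>(a) y y\<^sup>*\<close>, where \<open>\<omega>\<close> is the
  vector state of the conjugate of \<open>x\<close>.  The super-positive maps form a convex cone, so the inclusion passes to the
  generated cone.
\<close>
lemma separable_cone_subset_choi:
  "separable_cone \<subseteq> choi ` (super_positive_maps :: (complex^'n^'n \<Rightarrow> complex^'n^'n) set)"
proof -
  have scale: "choi (\<lambda>x. c *\<^sub>R \<phi> x) = c *\<^sub>R choi \<phi>" for c and \<phi> :: "complex^'n^'n \<Rightarrow> _"
    by (simp add: vec_eq_iff choi_nth)
  have add: "choi (\<lambda>x. \<phi> x + \<psi> x) = choi \<phi> + choi \<psi>" for \<phi> \<psi> :: "complex^'n^'n \<Rightarrow> _"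
    by (simp add: vec_eq_iff choi_nth)
  have conic: "c *\<^sub>R X \<in> choi ` super_positive_maps"
    if "X \<in> choi ` super_positive_maps" "0 \<le> c" for X :: "complex^('n \<times> 'n)^('n \<times> 'n)" and c
  proof -
    from that(1) obtain \<phi> where "X = choi \<phi>" and \<phi>: "\<phi> \<in> super_positive_maps" by blast
    then have "c *\<^sub>R X = choi (\<lambda>x. c *\<^sub>R \<phi> x)" by (simp only: scale)
    then show ?thesis using super_positive_scale[OF \<phi> that(2)] by (rule image_eqI)
  qed
  have convex: "convex (choi ` (super_positive_maps :: (complex^'n^'n \<Rightarrow> _) set))"
    unfolding convex_def
  proof (intro ballI allI impI)
    fix X Y :: "complex^('n \<times> 'n)^('n \<times> 'n)" and u v :: real
    assume X: "X \<in> choi ` super_positive_maps" and Y: "Y \<in> choi ` super_positive_maps"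
      and u: "0 \<le> u" and v: "0 \<le> v"
    obtain \<phi> \<psi> where eq: "u *\<^sub>R X = choi \<phi>" "v *\<^sub>R Y = choi \<psi>"
      and sp: "\<phi> \<in> super_positive_maps" "\<psi> \<in> super_positive_maps"
      using conic[OF X u] conic[OF Y v] by blast
    have "u *\<^sub>R X + v *\<^sub>R Y = choi (\<lambda>x. \<phi> x + \<psi> x)" by (simp only: eq add)
    then show "u *\<^sub>R X + v *\<^sub>R Y \<in> choi ` super_positive_maps"
      using super_positive_add[OF sp] by (rule image_eqI)
  qed
  have "rank_one (product_vector x y) \<in> choi ` super_positive_maps" if x: "norm x = 1" for x y :: "complex^'n"
  proof -
    let ?\<omega> = "\<lambda>a. sesq a (\<chi> i. cnj (x $ i)) (\<chi> i. cnj (x $ i))"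
    let ?\<phi> = "\<lambda>a. cscale (?\<omega> a) (rank_one y)"
    have one: "sesq (mat 1) u v = (\<Sum>i\<in>UNIV. cnj (u $ i) * v $ i)" for u v :: "complex^'n"
    proof -
      have "(\<Sum>j\<in>UNIV. cnj (u $ i) * (if i = j then 1 else 0) * v $ j) = cnj (u $ i) * v $ i" for i
        by (simp add: if_distrib[of "(*) _"] if_distrib[of "\<lambda>x. x * _"] cong: if_cong)
      then show ?thesis by (simp add: sesq_def mat_def)
    qed
    have "state ?\<omega>"
      using x linear_functional_sesq
      by (auto simp: state_def positive_functional_def one norm_eq_1_iff psd_iff_sesq)
    then have "?\<phi> \<in> super_positive_maps"
      using psd_rank_one[of y] unfolding super_positive_maps_def
      by (intro CollectI exI[of _ "1::nat"] exI[of _ "\<lambda>_. ?\<omega>"] exI[of _ "\<lambda>_. rank_one y"]) simp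
    moreover have "choi ?\<phi> = rank_one (product_vector x y)"
      by (simp add: vec_eq_iff choi_nth sesq_munit cscale_def rank_one_def product_vector_def mult_ac)
    ultimately show ?thesis by (intro image_eqI[of _ choi ?\<phi>]) simp_all
  qed
  then have "pure_products \<subseteq> choi ` (super_positive_maps :: (complex^'n^'n \<Rightarrow> _) set)"
    by (auto simp: pure_products_def)
  then have "convex hull pure_products \<subseteq> choi ` (super_positive_maps :: (complex^'n^'n \<Rightarrow> _) set)"
    using convex by (rule hull_minimal)
  then show ?thesis
    unfolding separable_cone_def
    by (rule hull_minimal) (use conic in \<open>auto simp: conic_def\<close>)
qed

section \<open>Duality between positive and super-positive maps\<close>

lemma inner_matrix: "inner A X = Re (\<Sum>p\<in>UNIV. \<Sum>q\<in>UNIV. cnj (A $ p $ q) * X $ p $ q)"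
  for A X :: "complex^'n^'n"
  by (simp add: inner_vec_def inner_complex_def)

text \<open>
  Turns the real functional of a separating hyperplane into a trace pairing: on Hermitian matrices
  the real inner product with \<open>A\<close> is the pairing with the Hermitian part of \<open>A\<close>.
\<close>
lemma trace_mult_hermitian_part:
  assumes X: "psd X"
  shows "trace (X ** (\<chi> p q. (A $ p $ q + cnj (A $ q $ p)) / 2)) = of_real (inner A X)"
proof -
  let ?S = "\<Sum>p\<in>UNIV. \<Sum>q\<in>UNIV. cnj (A $ p $ q) * X $ p $ q"
  have adj: "X $ p $ q = cnj (X $ q $ p)" for p q
    by (rule psd_adjoint_entry[OF X])
  have "trace (X ** (\<chi> p q. (A $ p $ q + cnj (A $ q $ p)) / 2)) =
      (\<Sum>p\<in>UNIV. \<Sum>q\<in>UNIV. A $ q $ p * X $ p $ q / 2 + cnj (A $ p $ q) * X $ p $ q / 2)"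
    unfolding trace_def matrix_matrix_mult_def
    by (intro sum.cong refl) (simp add: distrib_left add_divide_distrib mult.commute)
  also have "\<dots> = ((\<Sum>p\<in>UNIV. \<Sum>q\<in>UNIV. A $ q $ p * X $ p $ q) + ?S) / 2"
    by (simp only: sum.distrib sum_divide_distrib[symmetric] add_divide_distrib)
  also have "(\<Sum>p\<in>UNIV. \<Sum>q\<in>UNIV. A $ q $ p * X $ p $ q) =
      (\<Sum>p\<in>UNIV. \<Sum>q\<in>UNIV. A $ q $ p * cnj (X $ q $ p))"
    by (intro sum.cong refl) (simp only: adj[symmetric])
  also have "\<dots> = (\<Sum>q\<in>UNIV. \<Sum>p\<in>UNIV. A $ q $ p * cnj (X $ q $ p))"
    by (rule sum.swap)
  also have "\<dots> = cnj ?S" by simp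
  also have "(cnj ?S + ?S) / 2 = of_real (Re ?S)"
    using complex_add_cnj[of ?S] by (simp only: add.commute[of "cnj ?S"]) simp
  finally show ?thesis by (simp only: inner_matrix)
qed

text \<open>
  A map is therefore positive as soon as its Choi matrix pairs nonnegatively with all pure product
  states; this is what makes the separating functional a positive map.
\<close>
lemma sesq_choi_map_rank_one:
  "sesq (choi_map B (rank_one w)) v v =
    trace (rank_one (product_vector (\<chi> i. cnj (w $ i)) v) ** B)"
proof -
  have "sesq (choi_map B (rank_one w)) v v = (\<Sum>s\<in>UNIV. \<Sum>t\<in>UNIV. \<Sum>i\<in>UNIV. \<Sum>j\<in>UNIV.
      cnj (v $ s) * (w $ i * cnj (w $ j)) * B $ (i, s) $ (j, t) * v $ t)"
    by (simp add: sesq_def choi_map_def rank_one_def sum_distrib_left sum_distrib_right mult_ac)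
  also have "\<dots> = (\<Sum>i\<in>UNIV. \<Sum>j\<in>UNIV. \<Sum>s\<in>UNIV. \<Sum>t\<in>UNIV.
      cnj (v $ s) * (w $ i * cnj (w $ j)) * B $ (i, s) $ (j, t) * v $ t)"
    by (rule sum_swap_pairs)
  also have "\<dots> = sesq B (product_vector (\<chi> i. cnj (w $ i)) v) (product_vector (\<chi> i. cnj (w $ i)) v)"
    using sum_kron[of "\<lambda>i s j t. cnj (v $ s) * (w $ i * cnj (w $ j)) * B $ (i, s) $ (j, t) * v $ t"]
    by (simp add: sesq_def product_vector_def mult_ac)
  finally show ?thesis
    by (simp only: trace_mult_rank_one[symmetric] trace_mul_sym[of B])
qed

text \<open>
  The dual of the positive maps consists of super-positive maps.  Pairing with positive maps of
  Choi rank one shows first that \<open>C\<^sub>\<phi>\<close> is positive semidefinite, hence Hermitian, so that a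
  hyperplane separating \<open>C\<^sub>\<phi>\<close> from the separable cone can be taken Hermitian as well.  The map
  with this Hermitian Choi matrix is positive but would pair negatively with \<open>\<phi>\<close>.
\<close>
lemma super_positiveI:
  fixes \<phi> :: "complex^'n^'n \<Rightarrow> complex^'n^'n"
  assumes lin: "linear_map \<phi>"
    and nonneg: "\<And>\<beta>. \<beta> \<in> positive_maps \<Longrightarrow> 0 \<le> map_trace (\<beta> \<circ> \<phi>)"
  shows "\<phi> \<in> super_positive_maps"
proof -
  have pair: "0 \<le> trace (choi \<phi> ** B)" if "choi_map B \<in> positive_maps" for B
  proof -
    have "trace (choi \<phi> ** choi (choi_map B)) = map_trace (trace_adjoint (choi_map B) \<circ> \<phi>)"
      by (rule trace_choi_mult[OF linear_choi_map])
    then show ?thesis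
      using nonneg[OF trace_adjoint_positive[OF that]] by (simp only: choi_choi_map)
  qed
  have psd: "psd (choi \<phi>)"
    unfolding psd_iff_sesq
  proof
    fix z :: "complex^('n \<times> 'n)"
    have "choi_map (rank_one z) \<in> positive_maps"
      by (intro completely_positive_imp_positive completely_positive_choi_map_rank_one)
    from pair[OF this] show "0 \<le> sesq (choi \<phi>) z z"
      by (simp only: trace_mult_rank_one)
  qed
  have "choi \<phi> \<in> separable_cone"
  proof (rule ccontr)
    assume "choi \<phi> \<notin> separable_cone"
    then obtain A b where A: "inner A (choi \<phi>) < b" "\<And>X. X \<in> separable_cone \<Longrightarrow> b < inner A X"
      using separating_hyperplane_closed_point[OF convex_separable_cone closed_separable_cone]
      by blast
    have cone: "0 \<le> inner A X" if X: "X \<in> separable_cone" for X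
    proof (rule ccontr)
      assume neg: "\<not> 0 \<le> inner A X"
      \<comment> \<open>Far along a ray on which the functional is negative it would fall below its lower bound \<open>b\<close>.\<close>
      have "b < inner A ((\<bar>b\<bar> / (- inner A X)) *\<^sub>R X)"
        using neg X by (intro A(2) separable_cone_scale) (auto simp: divide_le_0_iff)
      then show False using neg by (simp add: field_simps)
    qed
    have "(0::complex^('n \<times> 'n)^('n \<times> 'n)) \<in> separable_cone"
      using separable_cone_scale[OF rank_one_product_in_separable_cone, of 0] by simp
    from A(2)[OF this] have "b < 0" by simp
    define B where "B = (\<chi> p q. (A $ p $ q + cnj (A $ q $ p)) / 2)"
    have "choi_map B \<in> positive_maps"
      by (rule positive_mapsI[OF linear_choi_map])
         (simp add: sesq_choi_map_rank_one B_def trace_mult_hermitian_part psd_rank_one cone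
            rank_one_product_in_separable_cone less_eq_complex_def)
    then have "0 \<le> trace (choi \<phi> ** B)" by (rule pair)
    then show False
      using A(1) \<open>b < 0\<close> by (simp add: B_def trace_mult_hermitian_part[OF psd] less_eq_complex_def)
  qed
  then obtain \<psi> where "choi \<phi> = choi \<psi>" "\<psi> \<in> super_positive_maps"
    using separable_cone_subset_choi by blast
  then show ?thesis
    using choi_inject[OF lin super_positive_linear] by metis
qed

text \<open>
  For \<open>a \<mapsto> \<omega>(a) v v\<^sup>*\<close> the form of the Choi matrix at \<open>z\<close> is \<open>\<omega>(d d\<^sup>*)\<close>, where \<open>d\<close> contracts \<open>v\<close> with the
  conjugate of the second tensor factor of \<open>z\<close>.
\<close>
lemma super_positive_imp_completely_positive:
  fixes \<phi> :: "complex^'n^'n \<Rightarrow> complex^'n^'n"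
  assumes "\<phi> \<in> super_positive_maps"
  shows "\<phi> \<in> completely_positive_maps"
proof -
  obtain m \<omega> a where \<phi>: "\<phi> = (\<lambda>x. \<Sum>i<(m::nat). cscale (\<omega> i x) (a i))"
    and \<omega>: "\<And>i. i < m \<Longrightarrow> state (\<omega> i)" and a: "\<And>i. i < m \<Longrightarrow> psd (a i)"
    using assms by (auto simp: super_positive_maps_def)
  have "(\<lambda>x. cscale (\<omega> i x) (a i)) \<in> completely_positive_maps" if i: "i < m" for i
  proof -
    have pos: "0 \<le> \<omega> i x" if "psd x" for x
      using \<omega>[OF i] that by (auto simp: state_def positive_functional_def)
    have lin: "linear_functional (\<omega> i)"
      using \<omega>[OF i] by (simp add: state_def positive_functional_def)
    obtain w :: "'n \<Rightarrow> complex^'n" where w: "a i = (\<Sum>k\<in>UNIV. rank_one (w k))"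
      using a[OF i] by (rule psd_sum_rank_one)
    have cp: "(\<lambda>x. cscale (\<omega> i x) (rank_one v)) \<in> completely_positive_maps" for v
    proof -
      have "linear_map (\<lambda>x. cscale (\<omega> i x) (rank_one v))"
        using lin by (simp add: linear_functional_iff linear_map_iff cscale_def vec_eq_iff algebra_simps)
      moreover have "psd (choi (\<lambda>x. cscale (\<omega> i x) (rank_one v)))"
        unfolding psd_iff_sesq
      proof
        fix z :: "complex^('n \<times> 'n)"
        define d where "d = (\<chi> j. \<Sum>t\<in>UNIV. v $ t * cnj (z $ (j, t)))"
        have r: "sesq (rank_one v) x y = (\<Sum>s\<in>UNIV. v $ s * cnj (x $ s)) * (\<Sum>t\<in>UNIV. cnj (v $ t) * y $ t)"
          for x y
          by (simp only: sum_product) (simp add: sesq_def rank_one_def mult_ac)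
        have "sesq (choi (\<lambda>x. cscale (\<omega> i x) (rank_one v))) z z =
            (\<Sum>k\<in>UNIV. \<Sum>l\<in>UNIV. rank_one d $ k $ l * \<omega> i (munit k l))"
          unfolding sesq_choi sesq_cscale r by (simp add: d_def rank_one_def mult_ac)
        also have "\<dots> = \<omega> i (rank_one d)"
          by (rule linear_expand[OF lin, symmetric])
        finally show "0 \<le> sesq (choi (\<lambda>x. cscale (\<omega> i x) (rank_one v))) z z"
          by (simp only: pos[OF psd_rank_one])
      qed
      ultimately show ?thesis by (simp add: completely_positive_iff_psd_choi)
    qed
    have "(\<lambda>x. cscale (\<omega> i x) (a i)) = (\<lambda>x. \<Sum>k\<in>UNIV. cscale (\<omega> i x) (rank_one (w k)))"
      by (simp add: w cscale_def vec_eq_iff sum_distrib_left fun_eq_iff)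
    then show ?thesis
      using completely_positive_sum[of UNIV "\<lambda>k x. cscale (\<omega> i x) (rank_one (w k))"] cp by simp
  qed
  then show ?thesis
    unfolding \<phi> by (intro completely_positive_sum[where f = "\<lambda>i x. cscale (\<omega> i x) (a i)"]) simp
qed

section \<open>Dual functionals, tensor maps and dual cones\<close>

lemma linear_map_id: "linear_map id"
  by (simp add: linear_map_iff)

lemma transpose_map_transpose_map: "transpose_map (transpose_map \<phi>) = \<phi>"
  by (simp add: transpose_map_def fun_eq_iff)

lemma tensor_map_choi:
  assumes "linear_map \<alpha>"
  shows "tensor_map id \<alpha> (choi \<phi>) = choi (\<alpha> \<circ> \<phi>)"
  by (simp add: choi_def linear_map_sum[OF linear_tensor_map] tensor_map_kron[OF linear_map_id assms])

text \<open>
  The functional with coefficient matrix \<open>C\<close> is \<open>x \<mapsto> Tr(x C\<^sup>t)\<close>, and transposition preserves positivity.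
\<close>
lemma positive_functional_iff_psd:
  assumes f: "\<And>x. f x = (\<Sum>p\<in>UNIV. \<Sum>q\<in>UNIV. x $ p $ q * C $ p $ q)"
  shows "positive_functional f \<longleftrightarrow> psd C"
proof
  assume "positive_functional f"
  then have pos: "0 \<le> f x" if "psd x" for x
    using that by (auto simp: positive_functional_def)
  show "psd C"
    unfolding psd_iff_sesq
  proof
    fix z
    have "f (rank_one (\<chi> p. cnj (z $ p))) = sesq C z z"
      by (simp add: f rank_one_def sesq_def mult_ac)
    then show "0 \<le> sesq C z z"
      using pos[OF psd_rank_one, of "\<chi> p. cnj (z $ p)"] by simp
  qed
next
  assume C: "psd C"
  have "psd (transpose C)"
    unfolding psd_iff_sesq
  proof
    fix v
    have "sesq (transpose C) v v = (\<Sum>i\<in>UNIV. \<Sum>j\<in>UNIV. cnj (v $ i) * C $ j $ i * v $ j)"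
      by (simp add: sesq_def transpose_def)
    also have "\<dots> = (\<Sum>j\<in>UNIV. \<Sum>i\<in>UNIV. cnj (v $ i) * C $ j $ i * v $ j)"
      by (rule sum.swap)
    also have "\<dots> = sesq C (\<chi> i. cnj (v $ i)) (\<chi> i. cnj (v $ i))"
      by (simp add: sesq_def mult_ac)
    finally show "0 \<le> sesq (transpose C) v v"
      using C by (simp add: psd_iff_sesq)
  qed
  moreover have "f x = trace (x ** transpose C)" for x
    by (simp add: f trace_def matrix_matrix_mult_def transpose_def)
  ultimately have "0 \<le> f x" if "psd x" for x
    using that by (simp add: trace_mult_psd_nonneg)
  moreover have "linear_functional f"
    using linear_sum_coeff[of "\<lambda>p q. C $ p $ q"] by (simp only: f[symmetric])
  ultimately show "positive_functional f"
    by (simp add: positive_functional_def)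
qed

text \<open>
  On simple tensors \<open>Tr(\<phi>(a) \<alpha>(b)\<^sup>t) = Tr(\<phi>(a) \<alpha>\<^sup>t(b\<^sup>t)) = Tr((\<gamma> \<circ> \<phi>)(a) b\<^sup>t)\<close>, so the composite
  is the dual functional of \<open>\<gamma> \<circ> \<phi>\<close>, whose coefficients are the entries of the Choi matrix.
\<close>
lemma dual_functional_tensor_map:
  assumes \<phi>: "linear_map \<phi>" and \<alpha>: "linear_map \<alpha>" and \<gamma>: "linear_map \<gamma>"
    and adj: "trace_adjoint \<gamma> = transpose_map \<alpha>"
  shows "positive_functional (dual_functional \<phi> \<circ> tensor_map id \<alpha>) \<longleftrightarrow> psd (choi (\<gamma> \<circ> \<phi>))"
proof (rule positive_functional_iff_psd)
  let ?f = "dual_functional \<phi> \<circ> tensor_map id \<alpha>"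
  have dual: "linear_functional (dual_functional \<phi>)"
    "\<And>a b. dual_functional \<phi> (kron a b) = trace (\<phi> a ** transpose b)"
    using theI'[OF ex1_dual_functional[OF \<phi>], folded dual_functional_def] by blast+
  have lin: "linear_functional ?f"
    using dual(1) linear_tensor_map[of id \<alpha>] by (simp add: linear_functional_iff linear_map_iff)
  have "?f (munit p q) = choi (\<gamma> \<circ> \<phi>) $ p $ q" for p q
  proof -
    let ?a = "munit (fst p) (fst q)" and ?b = "munit (snd p) (snd q)"
    have "?f (munit p q) = trace (\<phi> ?a ** transpose (\<alpha> ?b))"
      unfolding munit_kron[of p q] by (simp add: tensor_map_kron[OF linear_map_id \<alpha>] dual(2))
    also have "transpose (\<alpha> ?b) = trace_adjoint \<gamma> (munit (snd q) (snd p))"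
    proof -
      have "transpose (munit (snd q) (snd p)) = ?b"
        by (auto simp: munit_def transpose_def vec_eq_iff)
      then show ?thesis by (simp add: adj transpose_map_def)
    qed
    also have "trace (\<phi> ?a ** \<dots>) = trace (\<gamma> (\<phi> ?a) ** munit (snd q) (snd p))"
      by (rule trace_adjoint[OF \<gamma>])
    finally show ?thesis by (simp only: trace_mult_munit choi_nth comp_apply)
  qed
  then show "?f x = (\<Sum>p\<in>UNIV. \<Sum>q\<in>UNIV. x $ p $ q * choi (\<gamma> \<circ> \<phi>) $ p $ q)" for x
    using linear_expand[OF lin, of x] by simp
qed

text \<open>
  The pairing with \<open>\<psi>\<close> is the operator trace of \<open>\<psi>\<^sup>* \<circ> \<phi>\<close>, and \<open>\<psi>\<^sup>*\<close> runs through \<open>J\<close> together with \<open>\<psi>\<close>.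
\<close>
lemma symmetric_mapping_cone_dual_iff:
  assumes J: "J \<subseteq> positive_maps" "symmetric_cone J" and \<phi>: "\<phi> \<in> positive_maps"
  shows "\<phi> \<in> dual_cone J \<longleftrightarrow> (\<forall>\<gamma>\<in>J. 0 \<le> map_trace (\<gamma> \<circ> \<phi>))"
proof -
  have lin: "linear_map \<gamma>" if "\<gamma> \<in> J" for \<gamma>
    using J(1) that by (auto simp: positive_maps_def)
  have adj: "trace_adjoint \<gamma> \<in> J" if "\<gamma> \<in> J" for \<gamma>
    using J(2) that by (simp add: symmetric_cone_def)
  have "\<phi> \<in> dual_cone J \<longleftrightarrow> (\<forall>\<gamma>\<in>J. 0 \<le> map_trace (trace_adjoint \<gamma> \<circ> \<phi>))"
    using \<phi> lin by (simp add: dual_cone_def trace_choi_mult)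
  also have "\<dots> \<longleftrightarrow> (\<forall>\<gamma>\<in>J. 0 \<le> map_trace (\<gamma> \<circ> \<phi>))"
    using adj trace_adjoint_trace_adjoint[OF lin] by metis
  finally show ?thesis .
qed

theorem corollary3:
  fixes J :: "(complex^'n^'n \<Rightarrow> complex^'n^'n) set"
    and \<phi> :: "complex^'n^'n \<Rightarrow> complex^'n^'n"
  assumes "invariant_mapping_cone J"
    and "\<phi> \<in> positive_maps"
  shows "(\<phi> \<in> dual_cone J \<longleftrightarrow> (\<forall>\<alpha>\<in>J. \<phi> \<circ> \<alpha> \<in> completely_positive_maps)) \<and>
         (\<phi> \<in> dual_cone J \<longleftrightarrow> (\<forall>\<alpha>\<in>J. \<alpha> \<circ> \<phi> \<in> completely_positive_maps)) \<and>
         (\<phi> \<in> dual_cone J \<longleftrightarrow> (\<forall>\<alpha>\<in>J. positive_functional (dual_functional \<phi> \<circ> tensor_map id \<alpha>))) \<and>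
         (\<phi> \<in> dual_cone J \<longleftrightarrow> (\<forall>\<alpha>\<in>J. psd (tensor_map id \<alpha> (choi \<phi>)))) \<and>
         (\<phi> \<in> dual_cone J \<longleftrightarrow> (\<forall>\<alpha>\<in>J. \<phi> \<circ> \<alpha> \<in> super_positive_maps)) \<and>
         (\<phi> \<in> dual_cone J \<longleftrightarrow> (\<forall>\<alpha>\<in>J. \<alpha> \<circ> \<phi> \<in> super_positive_maps))"
proof -
  have J: "J \<subseteq> positive_maps" "symmetric_cone J"
    and inv: "\<And>\<gamma> \<alpha> \<beta>. \<gamma> \<in> J \<Longrightarrow> \<alpha> \<in> positive_maps \<Longrightarrow> \<beta> \<in> positive_maps \<Longrightarrow> \<alpha> \<circ> \<gamma> \<circ> \<beta> \<in> J"
    using assms(1) by (auto simp: invariant_mapping_cone_def mapping_cone_def)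
  have id: "id \<in> positive_maps"
    by (simp add: positive_maps_def linear_map_id)
  have lin: "linear_map \<beta>" if "\<beta> \<in> positive_maps" for \<beta> :: "complex^'n^'n \<Rightarrow> complex^'n^'n"
    using that by (simp add: positive_maps_def)
  have linJ: "linear_map \<alpha>" if "\<alpha> \<in> J" for \<alpha>
    using that J(1) by (auto intro: lin)
  have lin\<phi>: "linear_map \<phi>" by (rule lin[OF assms(2)])
  have i: "\<phi> \<in> dual_cone J \<longleftrightarrow> (\<forall>\<gamma>\<in>J. 0 \<le> map_trace (\<gamma> \<circ> \<phi>))"
    by (rule symmetric_mapping_cone_dual_iff[OF J assms(2)])
  have i_vi: "\<phi> \<circ> \<alpha> \<in> super_positive_maps" if "\<phi> \<in> dual_cone J" "\<alpha> \<in> J" for \<alpha>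
  proof (rule super_positiveI[OF linear_map_compose[OF lin\<phi> linJ[OF that(2)]]])
    fix \<beta> :: "complex^'n^'n \<Rightarrow> complex^'n^'n" assume \<beta>: "\<beta> \<in> positive_maps"
    \<comment> \<open>Cyclicity turns \<open>\<beta> \<circ> \<phi> \<circ> \<alpha>\<close> into \<open>(\<alpha> \<circ> \<beta>) \<circ> \<phi>\<close>.\<close>
    have "\<alpha> \<circ> \<beta> \<in> J" using inv[OF that(2) id \<beta>] by simp
    then have "0 \<le> map_trace ((\<alpha> \<circ> \<beta>) \<circ> \<phi>)"
      using that(1) i by blast
    also have "(\<alpha> \<circ> \<beta>) \<circ> \<phi> = \<alpha> \<circ> (\<beta> \<circ> \<phi>)" by (rule comp_assoc)
    also have "map_trace \<dots> = map_trace ((\<beta> \<circ> \<phi>) \<circ> \<alpha>)"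
      by (intro map_trace_commute linear_map_compose lin\<phi> linJ[OF that(2)] lin[OF \<beta>])
    finally show "0 \<le> map_trace (\<beta> \<circ> (\<phi> \<circ> \<alpha>))" by (simp only: comp_assoc)
  qed
  have i_vii: "\<alpha> \<circ> \<phi> \<in> super_positive_maps" if "\<phi> \<in> dual_cone J" "\<alpha> \<in> J" for \<alpha>
  proof (rule super_positiveI[OF linear_map_compose[OF linJ[OF that(2)] lin\<phi>]])
    fix \<beta> :: "complex^'n^'n \<Rightarrow> complex^'n^'n" assume \<beta>: "\<beta> \<in> positive_maps"
    have "\<beta> \<circ> \<alpha> \<in> J" using inv[OF that(2) \<beta> id] by simp
    then have "0 \<le> map_trace ((\<beta> \<circ> \<alpha>) \<circ> \<phi>)"
      using that(1) i by blast
    then show "0 \<le> map_trace (\<beta> \<circ> (\<alpha> \<circ> \<phi>))" by (simp only: comp_assoc)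
  qed
  have ii_i: "\<phi> \<in> dual_cone J" if "\<forall>\<alpha>\<in>J. \<phi> \<circ> \<alpha> \<in> completely_positive_maps"
    unfolding i
  proof
    fix \<gamma> assume \<gamma>: "\<gamma> \<in> J"
    have "0 \<le> map_trace (\<phi> \<circ> \<gamma>)"
      using that \<gamma> by (intro map_trace_nonneg) blast
    then show "0 \<le> map_trace (\<gamma> \<circ> \<phi>)"
      by (simp only: map_trace_commute[OF linJ[OF \<gamma>] lin\<phi>])
  qed
  have iii_i: "\<phi> \<in> dual_cone J" if "\<forall>\<alpha>\<in>J. \<alpha> \<circ> \<phi> \<in> completely_positive_maps"
    using that map_trace_nonneg by (auto simp: i)
  have iii: "\<alpha> \<circ> \<phi> \<in> completely_positive_maps \<longleftrightarrow> psd (choi (\<alpha> \<circ> \<phi>))" if "\<alpha> \<in> J" for \<alpha>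
    by (intro completely_positive_iff_psd_choi linear_map_compose lin\<phi> linJ[OF that])
  have adj: "trace_adjoint \<alpha> \<in> J" and tr: "transpose_map \<alpha> \<in> J" if "\<alpha> \<in> J" for \<alpha>
    using J(2) that by (simp_all add: symmetric_cone_def)
  have v_iii: "(\<forall>\<alpha>\<in>J. psd (tensor_map id \<alpha> (choi \<phi>))) \<longleftrightarrow> (\<forall>\<alpha>\<in>J. \<alpha> \<circ> \<phi> \<in> completely_positive_maps)"
    using iii by (simp add: tensor_map_choi[OF linJ])
  have iv_iii: "(\<forall>\<alpha>\<in>J. positive_functional (dual_functional \<phi> \<circ> tensor_map id \<alpha>)) \<longleftrightarrow>
      (\<forall>\<alpha>\<in>J. \<alpha> \<circ> \<phi> \<in> completely_positive_maps)" (is "?iv \<longleftrightarrow> ?iii")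
  proof
    assume ?iv
    show ?iii
    proof
      fix \<gamma> assume \<gamma>: "\<gamma> \<in> J"
      \<comment> \<open>Solves \<open>\<gamma>\<^sup>* = \<alpha>\<^sup>t\<close> for \<open>\<alpha>\<close>, so that (iv) for \<open>\<alpha>\<close> is a statement on \<open>\<gamma> \<circ> \<phi>\<close>.\<close>
      define \<alpha> where "\<alpha> = transpose_map (trace_adjoint \<gamma>)"
      have "\<alpha> \<in> J" unfolding \<alpha>_def by (intro tr adj \<gamma>)
      moreover have "trace_adjoint \<gamma> = transpose_map \<alpha>"
        by (simp only: \<alpha>_def transpose_map_transpose_map)
      ultimately have "psd (choi (\<gamma> \<circ> \<phi>))"
        using \<open>?iv\<close> dual_functional_tensor_map[OF lin\<phi> linJ linJ[OF \<gamma>]] by blast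
      then show "\<gamma> \<circ> \<phi> \<in> completely_positive_maps" by (simp only: iii[OF \<gamma>])
    qed
  next
    assume ?iii
    show ?iv
    proof
      fix \<alpha> assume \<alpha>: "\<alpha> \<in> J"
      define \<gamma> where "\<gamma> = trace_adjoint (transpose_map \<alpha>)"
      have \<gamma>: "\<gamma> \<in> J" unfolding \<gamma>_def by (intro tr adj \<alpha>)
      have "trace_adjoint \<gamma> = transpose_map \<alpha>"
        unfolding \<gamma>_def by (intro trace_adjoint_trace_adjoint linJ tr \<alpha>)
      from dual_functional_tensor_map[OF lin\<phi> linJ[OF \<alpha>] linJ[OF \<gamma>] this]
      show "positive_functional (dual_functional \<phi> \<circ> tensor_map id \<alpha>)"
        using \<open>?iii\<close> \<gamma> iii[OF \<gamma>] by blast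
    qed
  qed
  have ii: "\<phi> \<in> dual_cone J \<longleftrightarrow> (\<forall>\<alpha>\<in>J. \<phi> \<circ> \<alpha> \<in> completely_positive_maps)"
    using i_vi ii_i super_positive_imp_completely_positive by blast
  have vi: "\<phi> \<in> dual_cone J \<longleftrightarrow> (\<forall>\<alpha>\<in>J. \<phi> \<circ> \<alpha> \<in> super_positive_maps)"
    using i_vi ii_i super_positive_imp_completely_positive by blast
  have iii': "\<phi> \<in> dual_cone J \<longleftrightarrow> (\<forall>\<alpha>\<in>J. \<alpha> \<circ> \<phi> \<in> completely_positive_maps)"
    using i_vii iii_i super_positive_imp_completely_positive by blast
  have vii: "\<phi> \<in> dual_cone J \<longleftrightarrow> (\<forall>\<alpha>\<in>J. \<alpha> \<circ> \<phi> \<in> super_positive_maps)"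
    using i_vii iii_i super_positive_imp_completely_positive by blast
  show ?thesis
    using ii iii' vi vii iv_iii v_iii by simp
qed

end
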